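(* Let $U=SU(2)$, $K=SO(2)$, and let $N_U(K)$ denote the normalizer of $K$ in $U$. For $a\in U\setminus N_U(K)$, let $\mu_a$ be the normalized singular measure supported in $KaK$, and let $\mu_a^{(p)}$ be the convolution of $p$ copies of $\mu_a$. Then: (i) for every $a\in U\setminus N_U(K)$ and every integer $p\ge 3$, the measure $\mu_a^{(p)}$ is absolutely continuous with respect to the Haar measure $m_U$ on $U$, and $\mathrm{d}\mu_a^{(p)}/\mathrm{d}m_U\in L^2(U)$; (ii) there exists an element $a\in U\setminus N_U(K)$ for which $\mathrm{d}\mu_a^{(2)}/\mathrm{d}m_U$ is not in $L^2(U)$.
   Context: $SO(2)$ is regarded as the subgroup of $SU(2)$ consisting of its real matrices. $m_U$ and $m_K$ denote the normalized Haar measures of the compact groups $U$ and $K$, and $L^2(U)=L^2(U,m_U)$. For $a\in U$, the measure $\mu_a$ is the $K$-bi-invariant probability measure on $U$ defined by $$\int_U f\,\mathrm{d}\mu_a=\int_K\int_K f(k_1ak_2)\,\mathrm{d}m_K(k_1)\,\mathrm{d}m_K(k_2),\qquad f\in C(U);$$ its support is the double coset $KaK$. The convolution of measures $\mu,\nu$ on $U$ is defined by $\int_U f\,\mathrm{d}(\mu*\nu)=\int_U\int_U f(xy)\,\mathrm{d}\mu(x)\,\mathrm{d}\nu(y)$ for $f\in C(U)$, and $\mu^{(p)}=\mu*\cdots*\mu$ ($p$ factors). $\mathrm{d}\mu_a^{(p)}/\mathrm{d}m_U$ is the Radon–Nikodym derivative. It is a previously known fact (Gupta–Hare) that for $a\in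 U\setminus N_U(K)$ the measure $\mu_a^{(2)}$ is absolutely continuous with respect to $m_U$, so the derivative in (ii) exists as an element of $L^1(U)$. *)

theory Defs
  imports "HOL-Probability.Probability"
begin

definition ctranspose :: "complex^'n^'m \<Rightarrow> complex^'m^'n" where
  "ctranspose A = (\<chi> i j. cnj (A $ j $ i))"

definition SU2 :: "(complex^2^2) set" where
  "SU2 = {A. ctranspose A ** A = mat 1 \<and> det A = 1}"

definition SO2 :: "(complex^2^2) set" where
  "SO2 = {A \<in> SU2. \<forall>i j. A $ i $ j \<in> \<real>}"

definition normalizer_in :: "(complex^2^2) set \<Rightarrow> (complex^2^2) set \<Rightarrow> (complex^2^2) set" where
  "normalizer_in G H = {g \<in> G. (\<lambda>h. g ** h ** matrix_inv g) ` H = H}"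

text \<open>Here \<open>G\<close> is meant to be a compact matrix group. A measure on \<open>G\<close> has the trace of the
  Borel \<open>\<sigma>\<close>-algebra as its \<open>\<sigma>\<close>-algebra, so that its space is \<open>G\<close>, not the whole matrix space.\<close>

definition is_haar_measure :: "(complex^2^2) set \<Rightarrow> (complex^2^2) measure \<Rightarrow> bool" where
  "is_haar_measure G M \<longleftrightarrow> prob_space M \<and> sets M = sets (restrict_space borel G) \<and>
     (\<forall>g\<in>G. distr M M (\<lambda>x. g ** x) = M)"

definition haar_measure :: "(complex^2^2) set \<Rightarrow> (complex^2^2) measure" where
  "haar_measure G = (THE M. is_haar_measure G M)"

abbreviation m_U :: "(complex^2^2) measure" where
  "m_U \<equiv> haar_measure SU2"

abbreviation m_K :: "(complex^2^2) measure" where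
  "m_K \<equiv> haar_measure SO2"

text \<open>The next two measures on \<open>SU2\<close> are defined as image measures; the lemmas
  \<open>integral_double_coset_measure\<close> and \<open>integral_mconv\<close> below show that they have the
  integrals of continuous functions that determine them.\<close>

definition double_coset_measure ::
    "(complex^2^2) measure \<Rightarrow> complex^2^2 \<Rightarrow> (complex^2^2) measure" where
  "double_coset_measure M a =
     distr (M \<Otimes>\<^sub>M M) (restrict_space borel SU2) (\<lambda>(k1, k2). k1 ** a ** k2)"

definition mconv :: "(complex^2^2) measure \<Rightarrow> (complex^2^2) measure \<Rightarrow> (complex^2^2) measure" where
  "mconv M N = distr (M \<Otimes>\<^sub>M N) (restrict_space borel SU2) (\<lambda>(x, y). x ** y)"

text \<open>The empty convolution product is the unit mass at the identity matrix.\<close>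

primrec mconv_power :: "(complex^2^2) measure \<Rightarrow> nat \<Rightarrow> (complex^2^2) measure" where
  "mconv_power M 0 = return (restrict_space borel SU2) (mat 1)"
| "mconv_power M (Suc p) = mconv M (mconv_power M p)"

text \<open>Membership in \<open>L\<^sup>2\<close> for functions with values in \<open>[0, \<infinity>]\<close>, such as \<^const>\<open>RN_deriv\<close>.\<close>

definition in_L2 :: "'a measure \<Rightarrow> ('a \<Rightarrow> ennreal) \<Rightarrow> bool" where
  "in_L2 M f \<longleftrightarrow> f \<in> borel_measurable M \<and> (\<integral>\<^sup>+ x. (f x)\<^sup>2 \<partial>M) < \<infinity>"

lemma measurable_matrix_mult:
  fixes f g :: "'b \<Rightarrow> complex^2^2"
  assumes f: "f \<in> borel_measurable M" and g: "g \<in> borel_measurable M"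
  shows "(\<lambda>x. f x ** g x) \<in> borel_measurable M"
proof (rule borel_measurable_continuous_Pair[OF f g])
  show "continuous_on UNIV (\<lambda>x. fst x ** snd x :: complex^2^2)"
    unfolding matrix_matrix_mult_def by (intro continuous_intros)
qed

lemma ctranspose_mult: "ctranspose (A ** B) = ctranspose B ** ctranspose A"
  by (simp add: ctranspose_def matrix_matrix_mult_def vec_eq_iff mult.commute)

lemma SU2_mult:
  assumes "A \<in> SU2" "B \<in> SU2"
  shows "A ** B \<in> SU2"
proof -
  have "ctranspose (A ** B) ** (A ** B) = ctranspose B ** (ctranspose A ** A) ** B"
    by (simp add: ctranspose_mult matrix_mul_assoc)
  then show ?thesis
    using assms by (simp add: SU2_def det_mul)
qed

lemma SU2_entry_le_1:
  assumes "A \<in> SU2"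
  shows "norm (A $ i $ j) \<le> 1"
proof -
  have "(\<Sum>k\<in>UNIV. cnj (A $ k $ j) * A $ k $ j) = (ctranspose A ** A) $ j $ j"
    by (simp add: ctranspose_def matrix_matrix_mult_def)
  also have "\<dots> = 1"
    using assms by (simp add: SU2_def mat_def)
  finally have "complex_of_real (\<Sum>k\<in>UNIV. (norm (A $ k $ j))\<^sup>2) = complex_of_real 1"
    by (simp add: complex_norm_square mult.commute del: of_real_power)
  then have "(\<Sum>k\<in>UNIV. (norm (A $ k $ j))\<^sup>2) = 1"
    using of_real_eq_iff by blast
  moreover have "(norm (A $ i $ j))\<^sup>2 \<le> (\<Sum>k\<in>UNIV. (norm (A $ k $ j))\<^sup>2)"
    by (rule member_le_sum) auto
  ultimately show ?thesis
    by (simp add: abs_square_le_1)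
qed

lemma compact_SU2: "compact SU2"
proof -
  have "norm A \<le> 4" if "A \<in> SU2" for A :: "complex^2^2"
  proof -
    have "norm (A $ i) \<le> 2" for i
    proof -
      have "norm (A $ i) \<le> (\<Sum>j\<in>UNIV. norm (A $ i $ j))"
        unfolding norm_vec_def[of "A $ i"] by (rule L2_set_le_sum) simp
      also have "\<dots> \<le> 2"
        using SU2_entry_le_1[OF that, of i 1] SU2_entry_le_1[OF that, of i 2]
        by (simp add: sum_2)
      finally show ?thesis .
    qed
    from this[of 1] this[of 2] have "(\<Sum>i\<in>UNIV. norm (A $ i)) \<le> 4"
      by (simp add: sum_2)
    moreover have "norm A \<le> (\<Sum>i\<in>UNIV. norm (A $ i))"
      unfolding norm_vec_def[of A] by (rule L2_set_le_sum) simp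
    ultimately show ?thesis
      by (rule order_trans[rotated])
  qed
  then have "bounded SU2"
    by (auto simp: bounded_iff)
  moreover have "closed SU2"
  proof -
    have "continuous_on UNIV (\<lambda>A :: complex^2^2. ctranspose A ** A)"
      unfolding ctranspose_def matrix_matrix_mult_def by (intro continuous_intros)
    moreover have "continuous_on UNIV (\<lambda>A :: complex^2^2. det A)"
      unfolding det_2 by (intro continuous_intros)
    ultimately show ?thesis
      unfolding SU2_def Collect_conj_eq
      by (intro closed_Int closed_Collect_eq continuous_on_const)
  qed
  ultimately show ?thesis
    by (simp add: compact_eq_bounded_closed)
qed

lemma integrable_SU2_valued:
  fixes f :: "complex^2^2 \<Rightarrow> complex"
  assumes M: "prob_space M" and g: "g \<in> measurable M (restrict_space borel SU2)"
    and f: "continuous_on SU2 f"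
  shows "f \<in> borel_measurable (restrict_space borel SU2)" "integrable M (\<lambda>x. f (g x))"
proof -
  interpret prob_space M by fact
  show mf: "f \<in> borel_measurable (restrict_space borel SU2)"
    using f by (rule borel_measurable_continuous_on_restrict)
  obtain B where B: "\<And>A. A \<in> SU2 \<Longrightarrow> norm (f A) \<le> B"
    using compact_imp_bounded[OF compact_continuous_image[OF f compact_SU2]]
    by (auto simp: bounded_iff)
  show "integrable M (\<lambda>x. f (g x))"
  proof (rule integrable_const_bound)
    show "AE x in M. norm (f (g x)) \<le> B"
      using B measurable_space[OF g] by (auto simp: space_restrict_space)
    show "(\<lambda>x. f (g x)) \<in> borel_measurable M"
      using measurable_compose[OF g mf] .
  qed
qed

lemma measurable_restrict_borel_imp:
  "sets M = sets (restrict_space borel S) \<Longrightarrow> (\<lambda>x. x) \<in> borel_measurable M"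
  using measurable_restrict_space1[OF measurable_ident, of borel S]
  by (simp add: id_def cong: measurable_cong_sets)

lemma integral_double_coset_measure:
  fixes f :: "complex^2^2 \<Rightarrow> complex"
  assumes M: "is_haar_measure SO2 M" and a: "a \<in> SU2" and f: "continuous_on SU2 f"
  shows "(\<integral>x. f x \<partial>double_coset_measure M a) = (\<integral>k1. (\<integral>k2. f (k1 ** a ** k2) \<partial>M) \<partial>M)"
proof -
  have ps: "prob_space M" and sM: "sets M = sets (restrict_space borel SO2)"
    using M by (auto simp: is_haar_measure_def)
  interpret prob_space M by fact
  interpret pair_prob_space M M ..
  have sp: "space M = SO2"
    using sets_eq_imp_space_eq[OF sM] by (simp add: space_restrict_space)
  let ?g = "\<lambda>(k1, k2). k1 ** a ** k2"
  have id: "(\<lambda>x. x) \<in> borel_measurable M"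
    using sM by (rule measurable_restrict_borel_imp)
  have "?g \<in> borel_measurable (M \<Otimes>\<^sub>M M)"
    unfolding case_prod_unfold
    by (intro measurable_matrix_mult borel_measurable_const
        measurable_compose[OF measurable_fst id] measurable_compose[OF measurable_snd id])
  moreover have "?g \<in> space (M \<Otimes>\<^sub>M M) \<rightarrow> SU2"
    using a by (auto simp: space_pair_measure sp SO2_def intro!: SU2_mult)
  ultimately have g: "?g \<in> measurable (M \<Otimes>\<^sub>M M) (restrict_space borel SU2)"
    by (simp add: measurable_restrict_space2)
  note * = integrable_SU2_valued[OF P.prob_space_axioms g f]
  have "(\<integral>x. f x \<partial>double_coset_measure M a) = (\<integral>z. f (?g z) \<partial>(M \<Otimes>\<^sub>M M))"
    unfolding double_coset_measure_def by (rule integral_distr[OF g *(1)])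
  also have "\<dots> = (\<integral>k1. (\<integral>k2. f (k1 ** a ** k2) \<partial>M) \<partial>M)"
    using integral_fst'[OF *(2)] by simp
  finally show ?thesis .
qed

lemma integral_mconv:
  fixes f :: "complex^2^2 \<Rightarrow> complex"
  assumes M: "prob_space M" and sM: "sets M = sets (restrict_space borel SU2)"
    and N: "prob_space N" and sN: "sets N = sets (restrict_space borel SU2)"
    and f: "continuous_on SU2 f"
  shows "(\<integral>z. f z \<partial>mconv M N) = (\<integral>y. (\<integral>x. f (x ** y) \<partial>M) \<partial>N)"
proof -
  interpret M: prob_space M by fact
  interpret N: prob_space N by fact
  interpret pair_prob_space M N ..
  have sp: "space M = SU2" "space N = SU2"
    using sets_eq_imp_space_eq[OF sM] sets_eq_imp_space_eq[OF sN]
    by (auto simp: space_restrict_space)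
  let ?g = "\<lambda>(x, y). x ** y"
  have idM: "(\<lambda>x. x) \<in> borel_measurable M" and idN: "(\<lambda>x. x) \<in> borel_measurable N"
    using measurable_restrict_borel_imp[OF sM] measurable_restrict_borel_imp[OF sN] .
  have "?g \<in> borel_measurable (M \<Otimes>\<^sub>M N)"
    unfolding case_prod_unfold
    by (intro measurable_matrix_mult
        measurable_compose[OF measurable_fst idM] measurable_compose[OF measurable_snd idN])
  moreover have "?g \<in> space (M \<Otimes>\<^sub>M N) \<rightarrow> SU2"
    by (auto simp: space_pair_measure sp intro!: SU2_mult)
  ultimately have g: "?g \<in> measurable (M \<Otimes>\<^sub>M N) (restrict_space borel SU2)"
    by (simp add: measurable_restrict_space2)
  note * = integrable_SU2_valued[OF P.prob_space_axioms g f]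
  have "(\<integral>z. f z \<partial>mconv M N) = (\<integral>z. f (?g z) \<partial>(M \<Otimes>\<^sub>M N))"
    unfolding mconv_def by (rule integral_distr[OF g *(1)])
  also have "\<dots> = (\<integral>y. (\<integral>x. f (x ** y) \<partial>M) \<partial>N)"
    using integral_snd[of "\<lambda>x y. f (x ** y)"] *(2) by (simp add: case_prod_unfold)
  finally show ?thesis .
qed

end

theory Submission
  imports Defs
begin

text \<open>The obstacle is that \<open>\<mu> a\<close> is singular and that its convolution square
  need not have a square integrable density, so no L^2 estimate is at hand before the third power.
  The L^2 norm of the third power is therefore traded for a form in three copies of f, whose natural
  exponent is 3/2: the balanced case 2/3 + 2/3 + 2/3 = 2 of Young's inequality. The density f has
  inverse square root singularities at both ends of [2c^2 - 1, 1]. The power 3/2 turns them into the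
  exponent -3/4, which is integrable, and the power 2 into -1, which diverges logarithmically. The
  hypothesis on a enters as |c| < 1; for |c| = 1 the interval shrinks to a point.

  \<open>haar_measure\<close> is a definite description, so nothing can be computed before concrete
  models are identified with it: a uniform angle for K, and for U the radial projection of the
  uniform measure on the unit ball of C^2. That the height is then uniform on [-1, 1] is Archimedes'
  hat-box theorem.\<close>

text \<open>
  Functions on the double cosets of \<open>K\<close> are functions of the height \<open>z \<in> [-1, 1]\<close> on the sphere
  \<open>U/K\<close>, and Haar measure becomes \<open>dz/2\<close>. If the diagonal matrix \<open>a\<close> has height \<open>c\<close>, then \<open>a k a\<close>, with \<open>k\<close> the rotation
  by \<open>t\<close>, has height \<open>c\<^sup>2 - (1 - c\<^sup>2) cos 2t\<close>. So the convolution square of \<open>\<mu>\<^sub>a\<close> has an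
  arcsine density \<open>f\<close> of order \<open>(1 - z)\<^sup>-\<^sup>1\<^sup>/\<^sup>2\<close> at \<open>z = 1\<close>, which is not square integrable,
  although \<open>f\<^sup>3\<^sup>/\<^sup>2\<close> is integrable. The convolution cube has a density with square integral
  \<open>\<integral>\<integral> f(w) f(x) f(wx) dw dx\<close>, because \<open>\<mu>\<^sub>a\<close> is invariant under inversion, and by invariance this
  trilinear form is at most \<open>3 (\<integral> f\<^sup>3\<^sup>/\<^sup>2)\<^sup>2\<close>. Convolving with a probability measure does not
  increase the \<open>L\<^sup>2\<close> norm, which covers the larger powers.
\<close>

section \<open>Lebesgue measure under isometries\<close>

lemma nn_integral_lborel_translate:
  fixes f :: "'a::euclidean_space \<Rightarrow> ennreal"
  assumes [measurable]: "f \<in> borel_measurable borel"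
  shows "(\<integral>\<^sup>+x. f (c + x) \<partial>lborel) = (\<integral>\<^sup>+x. f x \<partial>lborel)"
proof -
  have "(\<integral>\<^sup>+x. f x \<partial>lborel) = (\<integral>\<^sup>+x. f x \<partial>distr lborel borel ((+) c))"
    by (simp add: lborel_distr_plus)
  then show ?thesis
    by (simp add: nn_integral_distr)
qed

text \<open>Integrate \<open>1\<^sub>A (T x) 1\<^sub>B (y - T x)\<close>, \<open>B\<close> the unit ball, over \<open>x\<close> and \<open>y\<close> in both orders:
  translation invariance gives \<open>|T\<^sup>-\<^sup>1 A| |B|\<close> and \<open>|A| |B|\<close>.\<close>

lemma lborel_distr_isometry:
  fixes T :: "'a::euclidean_space \<Rightarrow> 'a"
  assumes T: "linear T" and iso: "\<And>x. norm (T x) = norm x"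
  shows "distr lborel borel T = lborel"
proof (rule measure_eqI)
  fix A assume "A \<in> sets (distr lborel borel T)"
  then have [measurable]: "A \<in> sets borel" by simp
  have [measurable]: "T \<in> borel_measurable borel"
    by (intro borel_measurable_continuous_onI linear_continuous_on linear_linear[THEN iffD2] T)
  have "inj T"
    unfolding linear_injective_0[OF T] by (metis iso norm_eq_zero)
  then have "surj T"
    by (rule linear_injective_imp_surjective[OF T]) simp
  define B :: "'a set" where "B = ball 0 1"
  have [measurable]: "B \<in> sets borel" by (simp add: B_def)
  let ?F = "\<lambda>x y. indicator A (T x) * indicator B (y - T x) :: ennreal"
  let ?G = "\<lambda>x y. indicator A (T x + y) * indicator B (- T x) :: ennreal"
  have B_finite: "emeasure lborel B < \<infinity>"
    unfolding B_def by (rule emeasure_lborel_ball_finite)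
  have B_pos: "emeasure lborel B \<noteq> 0"
    unfolding B_def by (simp add: emeasure_ball order.strict_implies_not_eq[OF unit_ball_vol_pos, symmetric])
  have "emeasure (distr lborel borel T) A * emeasure lborel B
      = (\<integral>\<^sup>+x. indicator A (T x) * emeasure lborel B \<partial>lborel)"
    by (simp add: nn_integral_multc emeasure_distr flip: nn_integral_indicator)
      (simp add: nn_integral_distr flip: nn_integral_indicator)
  also have "\<dots> = (\<integral>\<^sup>+x. \<integral>\<^sup>+y. ?F x y \<partial>lborel \<partial>lborel)"
    using nn_integral_lborel_translate[of "indicator B" "- T x" for x]
    by (simp add: nn_integral_cmult)
  also have "\<dots> = (\<integral>\<^sup>+y. \<integral>\<^sup>+x. ?F x y \<partial>lborel \<partial>lborel)"
    by (rule lborel_pair.Fubini'[symmetric]) simp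
  also have "\<dots> = (\<integral>\<^sup>+y. \<integral>\<^sup>+x. ?G x y \<partial>lborel \<partial>lborel)"
  proof (rule nn_integral_cong)
    fix y :: 'a
    \<comment> \<open>Shifting x by a preimage of y removes y from the ball factor, which the
      isometry then reduces to the indicator of B at x.\<close>
    obtain w where "T w = y" using \<open>surj T\<close> by (metis surjD)
    then have "?F (w + x) y = ?G x y" for x
      using linear_add[OF T] by (simp add: add.commute)
    moreover have "(\<integral>\<^sup>+x. ?F (w + x) y \<partial>lborel) = (\<integral>\<^sup>+x. ?F x y \<partial>lborel)"
      by (rule nn_integral_lborel_translate) simp
    ultimately show "(\<integral>\<^sup>+x. ?F x y \<partial>lborel) = (\<integral>\<^sup>+x. ?G x y \<partial>lborel)"
      by simp
  qed
  also have "\<dots> = (\<integral>\<^sup>+x. \<integral>\<^sup>+y. ?G x y \<partial>lborel \<partial>lborel)"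
    by (rule lborel_pair.Fubini') simp
  also have "\<dots> = (\<integral>\<^sup>+x. emeasure lborel A * indicator B x \<partial>lborel)"
  proof (rule nn_integral_cong)
    fix x :: 'a
    have "indicator B (- T x) = (indicator B x :: ennreal)"
      by (simp add: B_def iso indicator_def)
    then show "(\<integral>\<^sup>+y. ?G x y \<partial>lborel) = emeasure lborel A * indicator B x"
      using nn_integral_lborel_translate[of "indicator A" "T x"] by (simp add: nn_integral_multc)
  qed
  also have "\<dots> = emeasure lborel A * emeasure lborel B"
    by (simp add: nn_integral_cmult)
  finally show "emeasure (distr lborel borel T) A = emeasure lborel A"
    using B_finite B_pos by (auto simp: ennreal_mult_cancel_left mult.commute[of _ "emeasure lborel B"])
qed simp

lemma nn_integral_lborel_isometry:
  fixes T :: "'a::euclidean_space \<Rightarrow> 'a" and f :: "'a \<Rightarrow> ennreal"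
  assumes T: "linear T" and iso: "\<And>x. norm (T x) = norm x"
    and [measurable]: "f \<in> borel_measurable borel"
  shows "(\<integral>\<^sup>+x. f (T x) \<partial>lborel) = (\<integral>\<^sup>+x. f x \<partial>lborel)"
proof -
  have [measurable]: "T \<in> borel_measurable borel"
    by (intro borel_measurable_continuous_onI linear_continuous_on linear_linear[THEN iffD2] T)
  have "(\<integral>\<^sup>+x. f x \<partial>distr lborel borel T) = (\<integral>\<^sup>+x. f (T x) \<partial>lborel)"
    by (simp add: nn_integral_distr)
  then show ?thesis
    by (simp add: lborel_distr_isometry[OF T iso])
qed

text \<open>The disc of radius sqrt t has area pi * t, linear in t, so the law of the squared
  modulus has constant density. Open rays are stable under intersection and generate the Borel sets,
  so these areas suffice. This stands in for polar coordinates.\<close>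

lemma distr_lborel_norm_complex_squared:
  "distr lborel borel (\<lambda>u::complex. (norm u)\<^sup>2) = density lborel (\<lambda>s. ennreal pi * indicator {0..} s)"
    (is "?M = ?N")
proof (rule measure_eqI_generator_eq[where E = "range lessThan" and \<Omega> = UNIV
      and A = "\<lambda>n. {..<real n}"])
  have em: "emeasure ?M {..<t} = ennreal (pi * max 0 t)" for t :: real
  proof (cases "t > 0")
    case True
    then have "(\<lambda>u::complex. (norm u)\<^sup>2) -` {..<t} \<inter> space lborel = ball 0 (sqrt t)"
      using real_sqrt_less_iff[of "(norm u)\<^sup>2" t for u :: complex] by auto
    then show ?thesis
      using True by (simp add: emeasure_distr emeasure_ball unit_ball_vol_2)
  next
    case False
    then have "(\<lambda>u::complex. (norm u)\<^sup>2) -` {..<t} \<inter> space lborel = {}"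
      by (auto simp: not_less dest: order.strict_trans2)
    then show ?thesis
      using False by (simp add: emeasure_distr max_def)
  qed
  show "emeasure ?M X = emeasure ?N X" if "X \<in> range lessThan" for X
  proof -
    from \<open>X \<in> range lessThan\<close> obtain t where X: "X = {..<t}" by auto
    have "emeasure ?N X = (\<integral>\<^sup>+s. ennreal pi * indicator {0..<t} s \<partial>lborel)"
      unfolding X by (auto simp: emeasure_density indicator_def intro!: nn_integral_cong)
    also have "\<dots> = ennreal (pi * max 0 t)"
      by (auto simp: nn_integral_cmult ennreal_mult'' max_def)
    finally show ?thesis
      using em X by simp
  qed
  show "emeasure ?M {..<real n} \<noteq> \<infinity>" for n
    using em by simp
  show "(\<Union>n. {..<real n}) = UNIV"
    using reals_Archimedean2 by blast
  show "sets ?M = sigma_sets UNIV (range lessThan)" "sets ?N = sigma_sets UNIV (range lessThan)"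
    by (simp_all add: borel_Iio)
  show "Int_stable (range (lessThan :: real \<Rightarrow> _))"
  proof (rule Int_stableI_image)
    show "\<exists>k\<in>UNIV. {..<i} \<inter> {..<j} = {..<k}" for i j :: real
      by (intro bexI[of _ "min i j"]) auto
  qed
qed auto

lemma nn_integral_norm_complex_squared:
  fixes g :: "real \<Rightarrow> ennreal"
  assumes [measurable]: "g \<in> borel_measurable borel"
  shows "(\<integral>\<^sup>+u. g ((norm (u::complex))\<^sup>2) \<partial>lborel) = ennreal pi * (\<integral>\<^sup>+s. g s * indicator {0..} s \<partial>lborel)"
proof -
  have "(\<integral>\<^sup>+u. g ((norm (u::complex))\<^sup>2) \<partial>lborel)
      = (\<integral>\<^sup>+s. g s \<partial>distr lborel borel (\<lambda>u::complex. (norm u)\<^sup>2))"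
    by (simp add: nn_integral_distr)
  also have "\<dots> = (\<integral>\<^sup>+s. ennreal pi * (g s * indicator {0..} s) \<partial>lborel)"
    by (simp add: distr_lborel_norm_complex_squared nn_integral_density mult_ac)
  finally show ?thesis
    by (simp add: nn_integral_cmult)
qed

section \<open>The groups and the Cartan decomposition\<close>

text \<open>The first column of a matrix in SU(2) determines the second, which identifies SU(2) with
  the unit sphere of C^2, that is, with the unit quaternions.\<close>

definition su2 :: "complex \<Rightarrow> complex \<Rightarrow> complex^2^2" where
  "su2 a b = (\<chi> i j. if i = 1 then (if j = 1 then a else - cnj b) else (if j = 1 then b else cnj a))"

lemma su2_nth [simp]:
  "su2 a b $ 1 $ 1 = a" "su2 a b $ 1 $ 2 = - cnj b" "su2 a b $ 2 $ 1 = b" "su2 a b $ 2 $ 2 = cnj a"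
  by (simp_all add: su2_def)

lemma su2_eq_iff: "su2 a b = su2 c d \<longleftrightarrow> a = c \<and> b = d"
  by (auto simp: vec_eq_iff forall_2)

lemma su2_mult: "su2 a b ** su2 c d = su2 (a * c - cnj b * d) (b * c + cnj a * d)"
  by (simp add: vec_eq_iff forall_2 matrix_matrix_mult_def sum_2 algebra_simps)

lemma su2_one: "su2 1 0 = mat 1"
  by (simp add: vec_eq_iff forall_2 mat_def)

lemma ctranspose_su2: "ctranspose (su2 a b) = su2 (cnj a) (- b)"
  by (simp add: vec_eq_iff forall_2 ctranspose_def)

lemma norm_squared_eq_1_iff: "(norm a)\<^sup>2 + (norm b)\<^sup>2 = 1 \<longleftrightarrow> a * cnj a + b * cnj b = 1" for a b :: complex
  by (simp add: complex_norm_square[symmetric] of_real_eq_1_iff flip: of_real_add of_real_power)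

lemma su2_in_SU2: "(norm a)\<^sup>2 + (norm b)\<^sup>2 = 1 \<Longrightarrow> su2 a b \<in> SU2"
  unfolding norm_squared_eq_1_iff
  by (simp add: SU2_def ctranspose_su2 su2_mult det_2 mult.commute flip: su2_one)

lemma SU2_cases:
  assumes "x \<in> SU2"
  obtains a b where "x = su2 a b" "(norm a)\<^sup>2 + (norm b)\<^sup>2 = 1"
proof -
  define a b c d where "a = x $ 1 $ 1" and "b = x $ 2 $ 1" and "c = x $ 1 $ 2" and "d = x $ 2 $ 2"
  have "ctranspose x ** x = mat 1" and det: "a * d - c * b = 1"
    using assms by (simp_all add: SU2_def det_2 a_def b_def c_def d_def)
  then have 1: "cnj a * a + cnj b * b = 1" and 2: "cnj a * c + cnj b * d = 0"
    by (simp_all add: vec_eq_iff forall_2 ctranspose_def matrix_matrix_mult_def sum_2 mat_def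
        a_def b_def c_def d_def)
  \<comment> \<open>Determinant one and orthogonality of the columns are two linear equations for
    the second column (c, d). Eliminating one unknown at a time, with the unit length of the first
    column, solves them.\<close>
  have "d = cnj a * (a * d - c * b) + b * (cnj a * c + cnj b * d)"
    using 1 by algebra
  then have d: "d = cnj a" using det 2 by simp
  have "c = a * (cnj a * c + cnj b * d) - cnj b * (a * d - c * b)"
    using 1 by algebra
  then have c: "c = - cnj b" using det 2 by simp
  have "x = su2 a b"
    using c d by (simp add: vec_eq_iff forall_2 a_def b_def c_def d_def)
  moreover have "(norm a)\<^sup>2 + (norm b)\<^sup>2 = 1"
    using 1 by (simp add: norm_squared_eq_1_iff mult.commute)
  ultimately show thesis by (rule that)
qed

lemma mat_1_in_SU2: "mat 1 \<in> SU2"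
  unfolding su2_one[symmetric] by (rule su2_in_SU2) simp

lemma ctranspose_in_SU2: "x \<in> SU2 \<Longrightarrow> ctranspose x \<in> SU2"
  by (elim SU2_cases) (auto simp: ctranspose_su2 intro!: su2_in_SU2)

lemma SU2_ctranspose_mult:
  assumes "x \<in> SU2"
  shows "ctranspose x ** x = mat 1" "x ** ctranspose x = mat 1"
proof -
  show "ctranspose x ** x = mat 1"
    using assms unfolding SU2_def by blast
  then show "x ** ctranspose x = mat 1"
    by (rule matrix_left_right_inverse[THEN iffD1])
qed

text \<open>\<open>matrix_inv\<close> is a Hilbert choice. The conjugate transpose witnesses that
  the chosen matrix is a two-sided inverse, and cancellation identifies the two.\<close>

lemma matrix_inv_SU2:
  assumes "x \<in> SU2"
  shows "matrix_inv x = ctranspose x"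
proof -
  have "x ** matrix_inv x = mat 1 \<and> matrix_inv x ** x = mat 1"
    unfolding matrix_inv_def by (rule someI[of _ "ctranspose x"]) (simp add: SU2_ctranspose_mult[OF assms])
  then have "ctranspose x ** (x ** matrix_inv x) = ctranspose x"
    by simp
  then show ?thesis
    by (simp add: matrix_mul_assoc SU2_ctranspose_mult[OF assms])
qed

definition rot :: "real \<Rightarrow> complex^2^2" where
  "rot t = su2 (of_real (cos t)) (of_real (sin t))"

lemma rot_add: "rot s ** rot t = rot (s + t)"
  by (simp add: rot_def su2_mult cos_add sin_add su2_eq_iff algebra_simps)

lemma rot_in_SO2 [simp]: "rot t \<in> SO2"
proof -
  have "rot t $ i $ j \<in> \<real>" for i j
    using exhaust_2[of i] exhaust_2[of j] by (auto simp: rot_def)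
  then show ?thesis
    by (simp add: SO2_def rot_def su2_in_SU2)
qed

lemma SO2_cases:
  assumes "x \<in> SO2"
  obtains t where "0 \<le> t" "t < 2 * pi" "x = rot t"
proof -
  have x: "x \<in> SU2" and real: "\<And>i j. x $ i $ j \<in> \<real>"
    using assms by (auto simp: SO2_def)
  from x obtain a b where ab: "x = su2 a b" "(norm a)\<^sup>2 + (norm b)\<^sup>2 = 1" by (rule SU2_cases)
  obtain p q where "a = of_real p" "b = of_real q"
    using real[of 1 1] real[of 2 1] ab by (auto elim!: Reals_cases)
  moreover from this have "p\<^sup>2 + q\<^sup>2 = 1" using ab by simp
  ultimately show thesis
    using sincos_total_2pi[of p q] ab that by (auto simp: rot_def)
qed

lemma SO2_eq_range_rot: "SO2 = range rot"
  by (auto elim: SO2_cases)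

lemma SO2_subset_SU2: "SO2 \<subseteq> SU2"
  by (auto simp: SO2_def)

lemma SO2_mult: "k \<in> SO2 \<Longrightarrow> l \<in> SO2 \<Longrightarrow> k ** l \<in> SO2"
  by (auto simp: SO2_eq_range_rot rot_add)

lemma SO2_commute: "k \<in> SO2 \<Longrightarrow> l \<in> SO2 \<Longrightarrow> k ** l = l ** k"
  by (auto simp: SO2_eq_range_rot rot_add add.commute)

lemma rot_periodic: "rot (t + 2 * pi) = rot t"
  by (simp add: rot_def)

text \<open>The height of \<open>x\<close>: the third coordinate of its image in \<open>SU(2)/SO(2) = S\<^sup>2\<close>.\<close>

definition zonal :: "complex^2^2 \<Rightarrow> real" where
  "zonal x = Re ((x $ 1 $ 1)\<^sup>2 + (x $ 2 $ 1)\<^sup>2)"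

lemma zonal_su2: "zonal (su2 a b) = (Re a)\<^sup>2 + (Re b)\<^sup>2 - (Im a)\<^sup>2 - (Im b)\<^sup>2"
  by (simp add: zonal_def power2_eq_square)

text \<open>A real rotation acts separately on the real and the imaginary part of the first column,
  and the height is the difference of their squared lengths. The Pythagorean simp rules are switched
  off so that the factor survives until both sides are expanded.\<close>

lemma zonal_rot_left: "zonal (rot t ** su2 a b) = zonal (su2 a b)"
proof -
  have "zonal (rot t ** su2 a b) = ((cos t)\<^sup>2 + (sin t)\<^sup>2) * zonal (su2 a b)"
    unfolding rot_def su2_mult zonal_su2
    by (simp add: power2_eq_square algebra_simps
        del: sin_cos_squared_add sin_cos_squared_add2 sin_cos_squared_add3)
  then show ?thesis by simp
qed

lemma zonal_rot_right: "zonal (su2 a b ** rot t) = zonal (su2 a b)"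
proof -
  have "zonal (su2 a b ** rot t) = ((cos t)\<^sup>2 + (sin t)\<^sup>2) * zonal (su2 a b)"
    unfolding rot_def su2_mult zonal_su2
    by (simp add: power2_eq_square algebra_simps
        del: sin_cos_squared_add sin_cos_squared_add2 sin_cos_squared_add3)
  then show ?thesis by simp
qed

lemma zonal_biinvariant:
  assumes "x \<in> SU2" "k \<in> SO2" "l \<in> SO2"
  shows "zonal (k ** x ** l) = zonal x"
proof -
  obtain s t where [simp]: "k = rot s" "l = rot t"
    using assms by (auto simp: SO2_eq_range_rot)
  obtain a b where x: "x = su2 a b"
    using assms by (auto elim: SU2_cases)
  obtain c d where y: "rot s ** su2 a b = su2 c d"
    by (simp add: rot_def su2_mult)
  then show ?thesis
    using zonal_rot_left[of s a b] zonal_rot_right[of c d t] by (simp add: x)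
qed

lemma zonal_ctranspose: "x \<in> SU2 \<Longrightarrow> zonal (ctranspose x) = zonal x"
  by (elim SU2_cases) (simp add: ctranspose_su2 zonal_su2)

lemma zonal_bounds:
  assumes "x \<in> SU2"
  shows "-1 \<le> zonal x" "zonal x \<le> 1"
proof -
  obtain a b where x: "x = su2 a b" "(norm a)\<^sup>2 + (norm b)\<^sup>2 = 1"
    using assms by (rule SU2_cases)
  have *: "(Re a)\<^sup>2 + (Re b)\<^sup>2 + (Im a)\<^sup>2 + (Im b)\<^sup>2 = 1"
    using x(2) by (simp add: cmod_power2)
  show "-1 \<le> zonal x" "zonal x \<le> 1"
    using zero_le_power2[of "Re a"] zero_le_power2[of "Re b"] zero_le_power2[of "Im a"]
      zero_le_power2[of "Im b"] * unfolding x(1) zonal_su2 by linarith+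
qed

text \<open>\<open>diag z\<close> is the representative of the double coset of height \<open>z\<close> in the diagonal torus;
  \<open>z\<close> is clamped to \<open>[-1, 1]\<close>.\<close>

definition diag :: "real \<Rightarrow> complex^2^2" where
  "diag z = (let w = max (-1) (min 1 z) in su2 (Complex (sqrt ((1 + w) / 2)) (sqrt ((1 - w) / 2))) 0)"

lemma diag_in_SU2: "diag z \<in> SU2"
  by (auto simp: diag_def Let_def cmod_power2 field_simps intro!: su2_in_SU2)

lemma zonal_diag: "-1 \<le> z \<Longrightarrow> z \<le> 1 \<Longrightarrow> zonal (diag z) = z"
  by (simp add: diag_def Let_def zonal_su2 field_simps)

text \<open>In the coordinates \<open>u = Re a + i Re b\<close> and \<open>v = Im a - i Im b\<close> of \<^term>\<open>su2 a b\<close>,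
  multiplying by \<^term>\<open>rot s\<close> from the left and \<^term>\<open>rot t\<close> from the right turns \<open>u\<close> by
  \<open>s + t\<close> and \<open>v\<close> by \<open>t - s\<close>.\<close>

lemma KAK_decomposition:
  assumes "x \<in> SU2"
  obtains k l where "k \<in> SO2" "l \<in> SO2" "x = k ** diag (zonal x) ** l"
proof -
  obtain a b where x: "x = su2 a b" and ab: "(norm a)\<^sup>2 + (norm b)\<^sup>2 = 1"
    using assms by (rule SU2_cases)
  define z where "z = zonal x"
  have z: "-1 \<le> z" "z \<le> 1" unfolding z_def using zonal_bounds[OF assms] .
  define u v where "u = Complex (Re a) (Re b)" and "v = Complex (Im a) (- Im b)"
  have "(norm u)\<^sup>2 + (norm v)\<^sup>2 = 1" "(norm u)\<^sup>2 - (norm v)\<^sup>2 = z"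
    using ab by (simp_all add: u_def v_def cmod_power2 z_def x zonal_su2)
  then have "(norm u)\<^sup>2 = (1 + z) / 2" "(norm v)\<^sup>2 = (1 - z) / 2"
    by auto
  then have nu: "norm u = sqrt ((1 + z) / 2)" and nv: "norm v = sqrt ((1 - z) / 2)"
    by (metis norm_ge_zero real_sqrt_unique)+
  \<comment> \<open>A vanishing \<open>u\<close> or \<open>v\<close> does no harm: its polar form
    holds with any argument.\<close>
  define p q where "p = Arg u" and "q = Arg v"
  have u: "u = norm u * cis p" and v: "v = norm v * cis q"
    by (simp_all add: p_def q_def rcis_cmod_Arg flip: rcis_def)
  define s t where "s = (p - q) / 2" and "t = (p + q) / 2"
  have p: "p = s + t" and q: "q = t - s" by (simp_all add: s_def t_def field_simps)
  have "Re u = norm u * cos p" "Im u = norm u * sin p" "Re v = norm v * cos q" "Im v = norm v * sin q"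
    using arg_cong[OF u, of Re] arg_cong[OF u, of Im] arg_cong[OF v, of Re] arg_cong[OF v, of Im]
    by simp_all
  then have "a = Complex (norm u * cos p) (norm v * cos q)" "b = Complex (norm u * sin p) (- norm v * sin q)"
    by (simp_all add: u_def v_def complex_eq_iff)
  moreover have "diag z = su2 (Complex (norm u) (norm v)) 0"
    using z by (simp add: diag_def nu nv)
  ultimately have "x = rot s ** diag z ** rot t"
    by (simp add: x rot_def su2_mult su2_eq_iff p q complex_eq_iff cos_add sin_add cos_diff sin_diff algebra_simps)
  then show thesis
    by (intro that[of "rot s" "rot t"]) (simp_all add: z_def)
qed

text \<open>This is the spherical law of cosines for two sides of length arccos c that enclose the
  angle pi - 2t. The angle is doubled because SU(2) covers the rotation group of the sphere
  twice.\<close>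

lemma zonal_diag_rot_diag:
  assumes "-1 \<le> c" "c \<le> 1"
  shows "zonal (diag c ** rot t ** diag c) = c\<^sup>2 - (1 - c\<^sup>2) * cos (2 * t)"
proof -
  define p q where "p = sqrt ((1 + c) / 2)" and "q = sqrt ((1 - c) / 2)"
  have pq: "p\<^sup>2 = (1 + c) / 2" "q\<^sup>2 = (1 - c) / 2"
    using assms by (simp_all add: p_def q_def)
  have "diag c = su2 (Complex p q) 0"
    using assms by (simp add: diag_def p_def q_def)
  then have "zonal (diag c ** rot t ** diag c) =
     ((p\<^sup>2 - q\<^sup>2) * cos t)\<^sup>2 + ((p\<^sup>2 + q\<^sup>2) * sin t)\<^sup>2 - (2 * p * q * cos t)\<^sup>2"
    by (simp add: rot_def su2_mult zonal_su2 power2_eq_square algebra_simps)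
  also have "\<dots> = ((p\<^sup>2 - q\<^sup>2)\<^sup>2 - 4 * p\<^sup>2 * q\<^sup>2) * (cos t)\<^sup>2 + (p\<^sup>2 + q\<^sup>2)\<^sup>2 * (sin t)\<^sup>2"
    by algebra
  \<comment> \<open>Here p^2 + q^2 = 1, p^2 - q^2 = c and 4 p^2 q^2 = 1 - c^2.\<close>
  also have "\<dots> = c\<^sup>2 * (cos t)\<^sup>2 + (sin t)\<^sup>2 - (1 - c\<^sup>2) * (cos t)\<^sup>2"
    unfolding pq by (simp add: power2_eq_square field_simps)
  also have "\<dots> = c\<^sup>2 - (1 - c\<^sup>2) * cos (2 * t)"
    unfolding cos_double sin_squared_eq by (simp add: algebra_simps)
  finally show ?thesis .
qed

section \<open>The Haar measures\<close>

lemma measure_eqI_nn_integral: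
  assumes "sets M = sets N"
    and "\<And>h. h \<in> borel_measurable M \<Longrightarrow> (\<integral>\<^sup>+x. h x \<partial>M) = (\<integral>\<^sup>+x. h x \<partial>N)"
  shows "M = N"
proof (rule measure_eqI)
  fix A assume A: "A \<in> sets M"
  then show "emeasure M A = emeasure N A"
    using assms(2)[of "indicator A"] assms(1) by simp
qed fact

lemma measurable_mult_restrict:
  fixes f g :: "'b \<Rightarrow> complex^2^2"
  assumes G: "\<And>x y. x \<in> G \<Longrightarrow> y \<in> G \<Longrightarrow> x ** y \<in> G"
    and f: "f \<in> measurable M (restrict_space borel G)" and g: "g \<in> measurable M (restrict_space borel G)"
  shows "(\<lambda>x. f x ** g x) \<in> measurable M (restrict_space borel G)"
proof (rule measurable_restrict_space2)
  show "(\<lambda>x. f x ** g x) \<in> space M \<rightarrow> G"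
    using measurable_space[OF f] measurable_space[OF g] G by (auto simp: space_restrict_space)
  show "(\<lambda>x. f x ** g x) \<in> borel_measurable M"
    using f g by (intro measurable_matrix_mult) (auto simp: measurable_restrict_space2_iff)
qed

text \<open>The definite description demands existence and uniqueness. For uniqueness, h (y ** x) is
  integrated over x by a competitor M and over y by N, in both orders: left invariance of M gives
  the integral of h under M, right invariance of N the one under N. This is why the concrete models
  are shown to be invariant on both sides.\<close>

lemma haar_measure_eqI:
  assumes G: "\<And>x y. x \<in> G \<Longrightarrow> y \<in> G \<Longrightarrow> x ** y \<in> G"
    and N: "prob_space N" and sets_N: "sets N = sets (restrict_space borel G)"
    and left: "\<And>g h. g \<in> G \<Longrightarrow> h \<in> borel_measurable N \<Longrightarrow> (\<integral>\<^sup>+x. h (g ** x) \<partial>N) = (\<integral>\<^sup>+x. h x \<partial>N)"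
    and right: "\<And>g h. g \<in> G \<Longrightarrow> h \<in> borel_measurable N \<Longrightarrow> (\<integral>\<^sup>+x. h (x ** g) \<partial>N) = (\<integral>\<^sup>+x. h x \<partial>N)"
  shows "haar_measure G = N"
  unfolding haar_measure_def
proof (rule the_equality)
  have space: "space M = G" if "sets M = sets (restrict_space borel G)" for M :: "(complex^2^2) measure"
    using sets_eq_imp_space_eq[OF that] by (simp add: space_restrict_space)
  have mult: "(\<lambda>x. g ** x) \<in> measurable M M"
    if "g \<in> G" and M: "sets M = sets (restrict_space borel G)" for g and M :: "(complex^2^2) measure"
  proof -
    have "(\<lambda>x. g ** x) \<in> measurable (restrict_space borel G) (restrict_space borel G)"
      using that(1) by (intro measurable_mult_restrict G measurable_const measurable_ident)
         (auto simp: space_restrict_space)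
    then show ?thesis
      using measurable_cong_sets[OF M M] by blast
  qed
  show "is_haar_measure G N"
    unfolding is_haar_measure_def
  proof (intro conjI ballI N sets_N)
    fix g assume "g \<in> G"
    then show "distr N N (\<lambda>x. g ** x) = N"
      by (intro measure_eqI_nn_integral) (simp_all add: nn_integral_distr mult sets_N left)
  qed
  fix M assume M: "is_haar_measure G M"
  then interpret M: prob_space M by (simp add: is_haar_measure_def)
  interpret N: prob_space N by fact
  interpret pair_prob_space M N ..
  have sets_M: "sets M = sets (restrict_space borel G)"
    using M by (simp add: is_haar_measure_def)
  show "M = N"
  proof (rule measure_eqI_nn_integral)
    fix h :: "_ \<Rightarrow> ennreal" assume h: "h \<in> borel_measurable M"
    have hN: "h \<in> borel_measurable N" and h': "h \<in> borel_measurable (restrict_space borel G)"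
      using h measurable_cong_sets[OF sets_M refl] measurable_cong_sets[OF sets_N refl] by blast+
    have meas: "(\<lambda>(x, y). h (y ** x)) \<in> borel_measurable (M \<Otimes>\<^sub>M N)"
    proof -
      have "fst \<in> measurable (M \<Otimes>\<^sub>M N) (restrict_space borel G)"
        "snd \<in> measurable (M \<Otimes>\<^sub>M N) (restrict_space borel G)"
        using measurable_fst[of M N] measurable_snd[of M N]
          measurable_cong_sets[OF refl sets_M] measurable_cong_sets[OF refl sets_N] by blast+
      then show ?thesis
        unfolding case_prod_unfold
        by (intro measurable_compose[OF measurable_mult_restrict h'] G)
    qed
    have "(\<integral>\<^sup>+x. h x \<partial>M) = (\<integral>\<^sup>+y. (\<integral>\<^sup>+x. h x \<partial>M) \<partial>N)"
      by (simp add: N.emeasure_space_1)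
    also have "\<dots> = (\<integral>\<^sup>+y. (\<integral>\<^sup>+x. h (y ** x) \<partial>M) \<partial>N)"
    proof (rule nn_integral_cong)
      fix y assume "y \<in> space N"
      then have y: "y \<in> G" using space[OF sets_N] by simp
      have "(\<integral>\<^sup>+x. h x \<partial>M) = (\<integral>\<^sup>+x. h x \<partial>distr M M (\<lambda>x. y ** x))"
        using M y by (simp add: is_haar_measure_def)
      also have "\<dots> = (\<integral>\<^sup>+x. h (y ** x) \<partial>M)"
        using h by (simp add: nn_integral_distr mult[OF y sets_M])
      finally show "(\<integral>\<^sup>+x. h x \<partial>M) = (\<integral>\<^sup>+x. h (y ** x) \<partial>M)" .
    qed
    also have "\<dots> = (\<integral>\<^sup>+x. (\<integral>\<^sup>+y. h (y ** x) \<partial>N) \<partial>M)"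
      using Fubini'[OF meas] by simp
    also have "\<dots> = (\<integral>\<^sup>+x. (\<integral>\<^sup>+y. h y \<partial>N) \<partial>M)"
      by (rule nn_integral_cong) (simp add: right hN space[OF sets_M])
    also have "\<dots> = (\<integral>\<^sup>+y. h y \<partial>N)"
      by (simp add: M.emeasure_space_1)
    finally show "(\<integral>\<^sup>+x. h x \<partial>M) = (\<integral>\<^sup>+y. h y \<partial>N)" .
  qed (simp add: sets_M sets_N)
qed

section \<open>Haar measure of SO(2) as a uniform angle\<close>

lemma nn_integral_periodic_shift:
  fixes f :: "real \<Rightarrow> ennreal"
  assumes [measurable]: "f \<in> borel_measurable borel" and per: "\<And>t. f (t + p) = f t"
    and s: "0 \<le> s" "s \<le> p"
  shows "(\<integral>\<^sup>+t. f (s + t) * indicator {0..<p} t \<partial>lborel) = (\<integral>\<^sup>+t. f t * indicator {0..<p} t \<partial>lborel)"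
proof -
  have "(\<integral>\<^sup>+t. f (s + t) * indicator {0..<p} t \<partial>lborel)
      = (\<integral>\<^sup>+t. f (s + t) * indicator {s..<s + p} (s + t) \<partial>lborel)"
    by (auto intro!: nn_integral_cong simp: indicator_def)
  also have "\<dots> = (\<integral>\<^sup>+t. f t * indicator {s..<s + p} t \<partial>lborel)"
    by (rule nn_integral_lborel_translate) simp
  \<comment> \<open>The shifted window is cut at p, and the overhanging piece is moved back by one
    period to fill the gap at 0.\<close>
  also have "\<dots> = (\<integral>\<^sup>+t. f t * indicator {s..<p} t + f t * indicator {p..<s + p} t \<partial>lborel)"
    using s by (auto intro!: nn_integral_cong simp: indicator_def)
  also have "\<dots> = (\<integral>\<^sup>+t. f t * indicator {s..<p} t \<partial>lborel) + (\<integral>\<^sup>+t. f t * indicator {p..<s + p} t \<partial>lborel)"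
    by (rule nn_integral_add) simp_all
  also have "(\<integral>\<^sup>+t. f t * indicator {p..<s + p} t \<partial>lborel)
      = (\<integral>\<^sup>+t. f (p + t) * indicator {p..<s + p} (p + t) \<partial>lborel)"
    by (rule nn_integral_lborel_translate[symmetric]) simp
  also have "\<dots> = (\<integral>\<^sup>+t. f t * indicator {0..<s} t \<partial>lborel)"
    using per by (auto intro!: nn_integral_cong simp: indicator_def add.commute)
  also have "(\<integral>\<^sup>+t. f t * indicator {s..<p} t \<partial>lborel) + \<dots>
      = (\<integral>\<^sup>+t. f t * indicator {s..<p} t + f t * indicator {0..<s} t \<partial>lborel)"
    by (rule nn_integral_add[symmetric]) simp_all
  also have "\<dots> = (\<integral>\<^sup>+t. f t * indicator {0..<p} t \<partial>lborel)"
    using s by (auto intro!: nn_integral_cong simp: indicator_def)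
  finally show ?thesis .
qed

lemma borel_measurable_rot [measurable]: "rot \<in> borel_measurable borel"
proof (intro borel_measurable_continuous_onI)
  have "continuous_on UNIV (\<lambda>t. if i = 1 then (if j = 1 then of_real (cos t) else - cnj (of_real (sin t)))
         else (if j = 1 then of_real (sin t) else cnj (of_real (cos t)) :: complex))" for i j :: 2
    by (cases "i = 1"; cases "j = 1") (auto intro!: continuous_intros)
  then show "continuous_on UNIV rot"
    unfolding rot_def su2_def by (intro continuous_intros)
qed

definition circle_measure :: "(complex^2^2) measure" where
  "circle_measure = distr (uniform_measure lborel {0..<2 * pi}) (restrict_space borel SO2) rot"

lemma measurable_rot: "rot \<in> measurable borel (restrict_space borel SO2)"
  by (rule measurable_restrict_space2) auto

lemma nn_integral_circle_measure:
  assumes "h \<in> borel_measurable (restrict_space borel SO2)"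
  shows "(\<integral>\<^sup>+k. h k \<partial>circle_measure)
    = (\<integral>\<^sup>+t. h (rot t) * indicator {0..<2 * pi} t \<partial>lborel) / ennreal (2 * pi)"
proof -
  have [measurable]: "(\<lambda>t. h (rot t)) \<in> borel_measurable borel"
    using measurable_compose[OF measurable_rot assms] .
  have "rot \<in> measurable (uniform_measure lborel {0..<2 * pi}) (restrict_space borel SO2)"
    using measurable_rot by (simp add: measurable_cong_sets[OF sets_uniform_measure refl])
  then show ?thesis
    unfolding circle_measure_def using assms
    by (simp add: nn_integral_distr nn_integral_uniform_measure)
qed

lemma m_K_eq: "m_K = circle_measure"
  and prob_space_m_K: "prob_space m_K"
  and sets_m_K: "sets m_K = sets (restrict_space borel SO2)"
  and nn_integral_m_K_left:
    "\<And>g h. g \<in> SO2 \<Longrightarrow> h \<in> borel_measurable m_K \<Longrightarrow> (\<integral>\<^sup>+x. h (g ** x) \<partial>m_K) = (\<integral>\<^sup>+x. h x \<partial>m_K)"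
  and nn_integral_m_K_right:
    "\<And>g h. g \<in> SO2 \<Longrightarrow> h \<in> borel_measurable m_K \<Longrightarrow> (\<integral>\<^sup>+x. h (x ** g) \<partial>m_K) = (\<integral>\<^sup>+x. h x \<partial>m_K)"
proof -
  have sets: "sets circle_measure = sets (restrict_space borel SO2)"
    by (simp add: circle_measure_def)
  have "prob_space (uniform_measure lborel {0..<2 * pi})"
    by (rule prob_space_uniform_measure) auto
  then have prob: "prob_space circle_measure"
    unfolding circle_measure_def using measurable_rot
    by (intro prob_space.prob_space_distr) (simp_all add: measurable_cong_sets[OF sets_uniform_measure refl])
  have left: "(\<integral>\<^sup>+x. h (g ** x) \<partial>circle_measure) = (\<integral>\<^sup>+x. h x \<partial>circle_measure)"
    if g: "g \<in> SO2" and h: "h \<in> borel_measurable circle_measure" for g h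
  proof -
    have h': "h \<in> borel_measurable (restrict_space borel SO2)"
      using h measurable_cong_sets[OF sets refl] by blast
    have gh: "(\<lambda>x. h (g ** x)) \<in> borel_measurable (restrict_space borel SO2)"
      using g by (intro measurable_compose[OF measurable_mult_restrict h'] SO2_mult measurable_const measurable_ident)
         (auto simp: space_restrict_space)
    have [measurable]: "(\<lambda>t. h (rot t)) \<in> borel_measurable borel"
      using measurable_compose[OF measurable_rot h'] .
    obtain s where s: "0 \<le> s" "s < 2 * pi" "g = rot s" using g by (rule SO2_cases)
    show ?thesis
      unfolding nn_integral_circle_measure[OF gh] nn_integral_circle_measure[OF h']
      using nn_integral_periodic_shift[of "\<lambda>t. h (rot t)" "2 * pi" s] s
      by (simp add: rot_add rot_periodic)
  qed
  have right: "(\<integral>\<^sup>+x. h (x ** g) \<partial>circle_measure) = (\<integral>\<^sup>+x. h x \<partial>circle_measure)"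
    if g: "g \<in> SO2" and h: "h \<in> borel_measurable circle_measure" for g h
    unfolding left[OF that, symmetric]
    using g by (intro nn_integral_cong) (simp add: circle_measure_def space_restrict_space SO2_commute)
  show eq: "m_K = circle_measure"
    using left right by (intro haar_measure_eqI SO2_mult prob sets) auto
  show "prob_space m_K" "sets m_K = sets (restrict_space borel SO2)"
    using prob sets by (simp_all add: eq)
  show "\<And>g h. g \<in> SO2 \<Longrightarrow> h \<in> borel_measurable m_K \<Longrightarrow> (\<integral>\<^sup>+x. h (g ** x) \<partial>m_K) = (\<integral>\<^sup>+x. h x \<partial>m_K)"
    "\<And>g h. g \<in> SO2 \<Longrightarrow> h \<in> borel_measurable m_K \<Longrightarrow> (\<integral>\<^sup>+x. h (x ** g) \<partial>m_K) = (\<integral>\<^sup>+x. h x \<partial>m_K)"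
    using left right by (simp_all add: eq)
qed

section \<open>Haar measure of SU(2) from the unit ball of C^2\<close>

definition normalized :: "complex \<times> complex \<Rightarrow> complex^2^2" where
  "normalized q = (if q = 0 then mat 1 else su2 (fst q / norm q) (snd q / norm q))"

text \<open>Multiplication in SU(2) extends to linear isometries of C^2, so starting from the ball
  instead of the sphere reduces invariance to that of Lebesgue measure. The origin is removed
  because \<open>normalized\<close> has only a default value there, which is not compatible with
  these isometries.\<close>

definition sphere_measure :: "(complex^2^2) measure" where
  "sphere_measure = distr (uniform_measure lborel (ball 0 1 - {0})) (restrict_space borel SU2) normalized"

lemma norm_prod_squared: "(norm q)\<^sup>2 = (norm (fst q))\<^sup>2 + (norm (snd q))\<^sup>2"
  by (cases q) (simp add: norm_Pair)

lemma normalized_in_SU2: "normalized q \<in> SU2"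
proof (cases "q = 0")
  case False
  then have "(norm (fst q / norm q))\<^sup>2 + (norm (snd q / norm q))\<^sup>2 = 1"
    by (simp add: norm_divide power_divide norm_prod_squared[symmetric] flip: add_divide_distrib)
  then show ?thesis
    using False by (simp add: normalized_def su2_in_SU2)
qed (simp add: normalized_def mat_1_in_SU2)

lemma borel_measurable_su2 [measurable (raw)]:
  assumes [measurable]: "f \<in> borel_measurable M" "g \<in> borel_measurable M"
  shows "(\<lambda>x. su2 (f x) (g x)) \<in> borel_measurable M"
proof (rule borel_measurable_continuous_Pair[OF assms])
  have "continuous_on UNIV (\<lambda>p. if i = 1 then (if j = 1 then fst p else - cnj (snd p))
         else (if j = 1 then snd p else cnj (fst p) :: complex))" for i j :: 2
    by (cases "i = 1"; cases "j = 1") (auto intro!: continuous_intros)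
  then show "continuous_on UNIV (\<lambda>p. su2 (fst p) (snd p))"
    unfolding su2_def by (intro continuous_intros)
qed

lemma measurable_normalized: "normalized \<in> measurable borel (restrict_space borel SU2)"
proof (rule measurable_restrict_space2)
  have [measurable]: "fst \<in> borel_measurable (borel :: (complex \<times> complex) measure)"
    "snd \<in> borel_measurable (borel :: (complex \<times> complex) measure)"
    by (intro borel_measurable_continuous_onI continuous_intros)+
  show "normalized \<in> borel_measurable borel"
    unfolding normalized_def[abs_def] by measurable
qed (simp add: normalized_in_SU2)

lemma emeasure_punctured_ball:
  "emeasure lborel (ball 0 1 - {0 :: 'a::euclidean_space}) \<noteq> 0"
  "emeasure lborel (ball 0 1 - {0 :: 'a::euclidean_space}) < \<infinity>"
proof -
  have "emeasure lborel (ball 0 1 - {0 :: 'a}) = emeasure lborel (ball 0 1 :: 'a set)"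
    by (subst emeasure_Diff) auto
  then show "emeasure lborel (ball 0 1 - {0 :: 'a}) \<noteq> 0" "emeasure lborel (ball 0 1 - {0 :: 'a}) < \<infinity>"
    using emeasure_lborel_ball_finite[of "0::'a" 1]
    by (simp_all add: emeasure_ball order.strict_implies_not_eq[OF unit_ball_vol_pos, symmetric])
qed

lemma nn_integral_sphere_measure:
  assumes "h \<in> borel_measurable (restrict_space borel SU2)"
  shows "(\<integral>\<^sup>+x. h x \<partial>sphere_measure)
    = (\<integral>\<^sup>+q. h (normalized q) * indicator (ball 0 1 - {0}) q \<partial>lborel)
      / emeasure lborel (ball 0 1 - {0 :: complex \<times> complex})"
proof -
  have [measurable]: "(\<lambda>q. h (normalized q)) \<in> borel_measurable borel"
    using measurable_compose[OF measurable_normalized assms] .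
  have "normalized \<in> measurable (uniform_measure lborel (ball 0 1 - {0})) (restrict_space borel SU2)"
    using measurable_normalized by (simp add: measurable_cong_sets[OF sets_uniform_measure refl])
  then show ?thesis
    unfolding sphere_measure_def using assms
    by (simp add: nn_integral_distr nn_integral_uniform_measure)
qed

text \<open>Radial projection carries \<open>T\<close> to \<phi> off the origin, and the punctured
  ball depends on the norm alone, so isometry invariance descends to the sphere.\<close>

lemma nn_integral_sphere_measure_isometry:
  fixes T :: "complex \<times> complex \<Rightarrow> complex \<times> complex"
  assumes T: "linear T" and iso: "\<And>q. norm (T q) = norm q"
    and equiv: "\<And>q. q \<noteq> 0 \<Longrightarrow> normalized (T q) = \<phi> (normalized q)"
    and \<phi>: "\<phi> \<in> measurable (restrict_space borel SU2) (restrict_space borel SU2)"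
    and h: "h \<in> borel_measurable (restrict_space borel SU2)"
  shows "(\<integral>\<^sup>+x. h (\<phi> x) \<partial>sphere_measure) = (\<integral>\<^sup>+x. h x \<partial>sphere_measure)"
proof -
  have [measurable]: "(\<lambda>q. h (normalized q)) \<in> borel_measurable borel"
    using measurable_compose[OF measurable_normalized h] .
  have [measurable]: "ball 0 1 - {0} \<in> sets (borel :: (complex \<times> complex) measure)"
    by (intro sets.Diff borel_open borel_closed) auto
  have T0: "T q = 0 \<longleftrightarrow> q = 0" for q
    using iso[of q] by (metis norm_eq_zero)
  have "(\<integral>\<^sup>+q. h (\<phi> (normalized q)) * indicator (ball 0 1 - {0}) q \<partial>lborel)
      = (\<integral>\<^sup>+q. h (normalized (T q)) * indicator (ball 0 1 - {0}) (T q) \<partial>lborel)"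
    by (intro nn_integral_cong) (auto simp: indicator_def equiv iso T0)
  also have "\<dots> = (\<integral>\<^sup>+q. h (normalized q) * indicator (ball 0 1 - {0}) q \<partial>lborel)"
    by (rule nn_integral_lborel_isometry[OF T iso]) measurable
  finally show ?thesis
    using h measurable_compose[OF \<phi> h] by (simp add: nn_integral_sphere_measure)
qed

lemma normalized_isometry:
  fixes T :: "complex \<times> complex \<Rightarrow> complex \<times> complex"
  assumes "norm (T q) = norm q" and "q \<noteq> 0"
    and "su2 (fst (T q) / norm q) (snd (T q) / norm q) = \<phi> (su2 (fst q / norm q) (snd q / norm q))"
  shows "normalized (T q) = \<phi> (normalized q)"
proof -
  have "T q \<noteq> 0" using assms by (metis norm_eq_zero)
  then show ?thesis using assms by (simp add: normalized_def)
qed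

text \<open>Multiplicativity of the quaternion norm, also known as Euler's four-square identity. It
  makes both left and right multiplication isometries.\<close>

lemma norm_su2_mult: "(norm (a * c - cnj b * d))\<^sup>2 + (norm (b * c + cnj a * d))\<^sup>2
    = ((norm a)\<^sup>2 + (norm b)\<^sup>2) * ((norm c)\<^sup>2 + (norm d)\<^sup>2)" for a b c d :: complex
  unfolding cmod_power2 by (simp add: power2_eq_square algebra_simps)

lemma m_U_eq: "m_U = sphere_measure"
  and prob_space_m_U: "prob_space m_U"
  and sets_m_U: "sets m_U = sets (restrict_space borel SU2)"
  and nn_integral_m_U_right:
    "\<And>g h. g \<in> SU2 \<Longrightarrow> h \<in> borel_measurable m_U \<Longrightarrow> (\<integral>\<^sup>+x. h (x ** g) \<partial>m_U) = (\<integral>\<^sup>+x. h x \<partial>m_U)"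
  and nn_integral_m_U_left:
    "\<And>g h. g \<in> SU2 \<Longrightarrow> h \<in> borel_measurable m_U \<Longrightarrow> (\<integral>\<^sup>+x. h (g ** x) \<partial>m_U) = (\<integral>\<^sup>+x. h x \<partial>m_U)"
proof -
  have sets: "sets sphere_measure = sets (restrict_space borel SU2)"
    by (simp add: sphere_measure_def)
  have "prob_space (uniform_measure lborel (ball 0 1 - {0 :: complex \<times> complex}))"
    using emeasure_punctured_ball[where 'a = "complex \<times> complex"]
    by (intro prob_space_uniform_measure) auto
  then have prob: "prob_space sphere_measure"
    unfolding sphere_measure_def using measurable_normalized
    by (intro prob_space.prob_space_distr) (simp_all add: measurable_cong_sets[OF sets_uniform_measure refl])
  have left: "(\<integral>\<^sup>+x. h (g ** x) \<partial>sphere_measure) = (\<integral>\<^sup>+x. h x \<partial>sphere_measure)"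
    if g: "g \<in> SU2" and h: "h \<in> borel_measurable sphere_measure" for g h
  proof -
    have h': "h \<in> borel_measurable (restrict_space borel SU2)"
      using h measurable_cong_sets[OF sets refl] by blast
    obtain c d where cd: "g = su2 c d" "(norm c)\<^sup>2 + (norm d)\<^sup>2 = 1"
      using g by (rule SU2_cases)
    define T where "T = (\<lambda>q. (c * fst q - cnj d * snd q, d * fst q + cnj c * snd q))"
    have iso: "norm (T q) = norm q" for q
      using norm_su2_mult[of c "fst q" d "snd q"] cd(2)
      by (simp add: T_def norm_Pair norm_prod_def)
    show ?thesis
    proof (rule nn_integral_sphere_measure_isometry[OF _ iso _ _ h'])
      show "linear T"
        by (rule linearI) (simp_all add: T_def algebra_simps)
      show "normalized (T q) = g ** normalized q" if "q \<noteq> 0" for q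
        using iso[of q] that
        by (rule normalized_isometry[where \<phi> = "\<lambda>x. g ** x"]) (simp add: T_def cd su2_mult su2_eq_iff diff_divide_distrib add_divide_distrib)
      show "(\<lambda>x. g ** x) \<in> measurable (restrict_space borel SU2) (restrict_space borel SU2)"
        using g by (intro measurable_mult_restrict SU2_mult measurable_const measurable_ident)
          (auto simp: space_restrict_space)
    qed
  qed
  have right: "(\<integral>\<^sup>+x. h (x ** g) \<partial>sphere_measure) = (\<integral>\<^sup>+x. h x \<partial>sphere_measure)"
    if g: "g \<in> SU2" and h: "h \<in> borel_measurable sphere_measure" for g h
  proof -
    have h': "h \<in> borel_measurable (restrict_space borel SU2)"
      using h measurable_cong_sets[OF sets refl] by blast
    obtain c d where cd: "g = su2 c d" "(norm c)\<^sup>2 + (norm d)\<^sup>2 = 1"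
      using g by (rule SU2_cases)
    \<comment> \<open>Right multiplication conjugates coordinates, so this map is linear over the
      reals only, which is the linearity that the isometry lemma asks for.\<close>
    define T where "T = (\<lambda>q. (fst q * c - cnj (snd q) * d, snd q * c + cnj (fst q) * d))"
    have iso: "norm (T q) = norm q" for q
      using norm_su2_mult[of "fst q" c "snd q" d] cd(2)
      by (simp add: T_def norm_Pair norm_prod_def)
    show ?thesis
    proof (rule nn_integral_sphere_measure_isometry[OF _ iso _ _ h'])
      show "linear T"
        by (rule linearI) (simp_all add: T_def algebra_simps scaleR_conv_of_real)
      show "normalized (T q) = normalized q ** g" if "q \<noteq> 0" for q
        using iso[of q] that
        by (rule normalized_isometry[where \<phi> = "\<lambda>x. x ** g"])
          (simp add: T_def cd su2_mult su2_eq_iff diff_divide_distrib add_divide_distrib)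
      show "(\<lambda>x. x ** g) \<in> measurable (restrict_space borel SU2) (restrict_space borel SU2)"
        using g by (intro measurable_mult_restrict SU2_mult measurable_const measurable_ident)
          (auto simp: space_restrict_space)
    qed
  qed
  show eq: "m_U = sphere_measure"
    using left right by (intro haar_measure_eqI SU2_mult prob sets) auto
  show "prob_space m_U" "sets m_U = sets (restrict_space borel SU2)"
    using prob sets by (simp_all add: eq)
  show "\<And>g h. g \<in> SU2 \<Longrightarrow> h \<in> borel_measurable m_U \<Longrightarrow> (\<integral>\<^sup>+x. h (x ** g) \<partial>m_U) = (\<integral>\<^sup>+x. h x \<partial>m_U)"
    "\<And>g h. g \<in> SU2 \<Longrightarrow> h \<in> borel_measurable m_U \<Longrightarrow> (\<integral>\<^sup>+x. h (g ** x) \<partial>m_U) = (\<integral>\<^sup>+x. h x \<partial>m_U)"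
    using left right by (simp_all add: eq)
qed

section \<open>The zonal coordinate under Haar measure\<close>

lemma borel_measurable_zonal [measurable]: "zonal \<in> borel_measurable borel"
  unfolding zonal_def by (intro borel_measurable_continuous_onI continuous_intros)

text \<open>In the coordinates r = s + t and z = (s - t) / (s + t) the triangle becomes a rectangle,
  and the Jacobian r / 2 does not involve z, so the integral factors. The change of variables is a
  translation from t to r followed, for fixed r, by the affine substitution s = r / 2 + (r / 2)
  z.\<close>

lemma nn_integral_quotient_triangle:
  fixes g :: "real \<Rightarrow> ennreal"
  assumes [measurable]: "g \<in> borel_measurable borel"
  shows "(\<integral>\<^sup>+s. (\<integral>\<^sup>+t. g ((s - t) / (s + t)) * indicator {0<..<1} (s + t) * indicator {0..} t \<partial>lborel)
            * indicator {0..} s \<partial>lborel)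
    = (\<integral>\<^sup>+r. ennreal (r / 2) * indicator {0<..<1} r \<partial>lborel) * (\<integral>\<^sup>+z. g z * indicator {-1..1} z \<partial>lborel)"
    (is "?L = ?C * ?I")
proof -
  let ?H = "\<lambda>s r. g ((2 * s - r) / r) * (indicator {0<..<1} r * indicator {0..} s * indicator {0..} (r - s)) :: ennreal"
  have "?L = (\<integral>\<^sup>+s. (\<integral>\<^sup>+t. g ((s - t) / (s + t)) * indicator {0<..<1} (s + t) * indicator {0..} t
      * indicator {0..} s \<partial>lborel) \<partial>lborel)"
    by (simp add: nn_integral_multc)
  also have "\<dots> = (\<integral>\<^sup>+s. (\<integral>\<^sup>+t. ?H s (s + t) \<partial>lborel) \<partial>lborel)"
    by (intro nn_integral_cong) (simp add: mult_ac)
  also have "\<dots> = (\<integral>\<^sup>+s. (\<integral>\<^sup>+r. ?H s r \<partial>lborel) \<partial>lborel)"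
    by (intro nn_integral_cong nn_integral_lborel_translate) measurable
  also have "\<dots> = (\<integral>\<^sup>+r. (\<integral>\<^sup>+s. ?H s r \<partial>lborel) \<partial>lborel)"
    by (rule lborel_pair.Fubini'[symmetric]) measurable
  also have "\<dots> = (\<integral>\<^sup>+r. ennreal (r / 2) * indicator {0<..<1} r * ?I \<partial>lborel)"
  proof (rule nn_integral_cong)
    fix r :: real
    show "(\<integral>\<^sup>+s. ?H s r \<partial>lborel) = ennreal (r / 2) * indicator {0<..<1} r * ?I"
    proof (cases "0 < r \<and> r < 1")
      case True
      have "(\<integral>\<^sup>+s. ?H s r \<partial>lborel) = ennreal \<bar>r / 2\<bar> * (\<integral>\<^sup>+z. ?H (r / 2 + r / 2 * z) r \<partial>lborel)"
        using True by (intro nn_integral_real_affine) auto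
      also have "(\<integral>\<^sup>+z. ?H (r / 2 + r / 2 * z) r \<partial>lborel) = ?I"
      proof (rule nn_integral_cong)
        fix z :: real
        have "r / 2 + r / 2 * z = r / 2 * (z + 1)" "r - (r / 2 + r / 2 * z) = r / 2 * (1 - z)"
          by (simp_all add: field_simps)
        moreover have "0 \<le> r / 2 * (z + 1) \<longleftrightarrow> -1 \<le> z" "0 \<le> r / 2 * (1 - z) \<longleftrightarrow> z \<le> 1"
          using True by (auto simp: zero_le_mult_iff)
        ultimately have "0 \<le> r / 2 + r / 2 * z \<longleftrightarrow> -1 \<le> z" "0 \<le> r - (r / 2 + r / 2 * z) \<longleftrightarrow> z \<le> 1"
          by metis+
        moreover have "(2 * (r / 2 + r / 2 * z) - r) / r = z"
          using True by (simp add: field_simps)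
        ultimately show "?H (r / 2 + r / 2 * z) r = g z * indicator {-1..1} z"
          using True by (simp only:) (simp add: indicator_def)
      qed
      finally show ?thesis using True by simp
    qed auto
  qed
  also have "\<dots> = ?C * ?I"
    by (simp add: nn_integral_multc)
  finally show ?thesis .
qed

lemma nn_integral_sphere_zonal:
  fixes g :: "real \<Rightarrow> ennreal"
  assumes [measurable]: "g \<in> borel_measurable borel"
  shows "(\<integral>\<^sup>+q. g (zonal (normalized q)) * indicator (ball 0 1 - {0}) q \<partial>lborel)
    = ennreal pi * (ennreal pi * ((\<integral>\<^sup>+r. ennreal (r / 2) * indicator {0<..<1} r \<partial>lborel)
        * (\<integral>\<^sup>+z. g z * indicator {-1..1} z \<partial>lborel)))"
    (is "?L = _")
proof -
  define F where "F = (\<lambda>s t. g ((s - t) / (s + t)) * indicator {0<..<1::real} (s + t))"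
  have F_meas [measurable]: "case_prod F \<in> borel_measurable (borel \<Otimes>\<^sub>M borel)"
    unfolding F_def case_prod_unfold by measurable
  \<comment> \<open>\<open>R\<close> regroups the four real coordinates, up to a sign, so that the
    height becomes the difference of the squared moduli of the two components, divided by their
    sum.\<close>
  define R :: "complex \<times> complex \<Rightarrow> complex \<times> complex"
    where "R = (\<lambda>q. (Complex (Re (fst q)) (Re (snd q)), Complex (Im (fst q)) (- Im (snd q))))"
  have R: "linear R"
    by (rule linearI) (simp_all add: R_def complex_eq_iff)
  have norm_R: "norm (R q) = norm q" for q
    by (simp add: R_def norm_prod_def cmod_power2)
  let ?F = "\<lambda>q :: complex \<times> complex. F ((norm (fst q))\<^sup>2) ((norm (snd q))\<^sup>2)"
  have fst_snd [measurable]: "fst \<in> borel_measurable (borel :: (complex \<times> complex) measure)"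
    "snd \<in> borel_measurable (borel :: (complex \<times> complex) measure)"
    by (intro borel_measurable_continuous_onI continuous_intros)+
  have "?L = (\<integral>\<^sup>+q. ?F (R q) \<partial>lborel)"
  proof (rule nn_integral_cong)
    fix q :: "complex \<times> complex"
    define s t where "s = (norm (fst (R q)))\<^sup>2" and "t = (norm (snd (R q)))\<^sup>2"
    have st: "s + t = (norm q)\<^sup>2"
      using norm_prod_squared[of "R q"] by (simp add: s_def t_def norm_R)
    show "g (zonal (normalized q)) * indicator (ball 0 1 - {0}) q = ?F (R q)"
    proof (cases "q = 0")
      case True
      then show ?thesis
        by (simp add: F_def linear_0[OF R])
    next
      case False
      have "zonal (normalized q) = (s - t) / (s + t)"
        using False unfolding st
        by (simp add: normalized_def zonal_su2 s_def t_def R_def cmod_power2 power_divide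
            add_divide_distrib diff_divide_distrib)
      moreover have "indicator (ball 0 1 - {0}) q = (indicator {0<..<1} (s + t) :: ennreal)"
        using False unfolding st by (auto simp: indicator_def abs_square_less_1)
      ultimately show ?thesis
        by (simp add: F_def s_def t_def)
    qed
  qed
  also have "\<dots> = (\<integral>\<^sup>+q. ?F q \<partial>lborel)"
    by (rule nn_integral_lborel_isometry[OF R norm_R]) measurable
  also have "\<dots> = (\<integral>\<^sup>+u. (\<integral>\<^sup>+v. ?F (u, v) \<partial>lborel) \<partial>lborel)"
    unfolding lborel_prod[symmetric]
    by (rule lborel.nn_integral_fst[symmetric]) measurable
  also have "\<dots> = (\<integral>\<^sup>+u. ennreal pi * (\<integral>\<^sup>+t. F ((norm (u::complex))\<^sup>2) t * indicator {0..} t \<partial>lborel) \<partial>lborel)"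
    by (simp add: nn_integral_norm_complex_squared)
  also have "\<dots> = ennreal pi * (\<integral>\<^sup>+s. ennreal pi * (\<integral>\<^sup>+t. F s t * indicator {0..} t \<partial>lborel) * indicator {0..} s \<partial>lborel)"
    by (rule nn_integral_norm_complex_squared) measurable
  also have "\<dots> = ennreal pi * (ennreal pi * (\<integral>\<^sup>+s. (\<integral>\<^sup>+t. F s t * indicator {0..} t \<partial>lborel) * indicator {0..} s \<partial>lborel))"
    by (simp add: mult.assoc nn_integral_cmult)
  finally show ?thesis
    unfolding F_def by (simp only: nn_integral_quotient_triangle[OF assms])
qed

lemma nn_integral_m_U_zonal:
  fixes g :: "real \<Rightarrow> ennreal"
  assumes [measurable]: "g \<in> borel_measurable borel"
  shows "(\<integral>\<^sup>+x. g (zonal x) \<partial>m_U) = (\<integral>\<^sup>+z. g z * indicator {-1..1} z \<partial>lborel) / 2"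
proof -
  define C where "C = ennreal pi * (ennreal pi * (\<integral>\<^sup>+r. ennreal (r / 2) * indicator {0<..<1} r \<partial>lborel))
      / emeasure lborel (ball 0 1 - {0 :: complex \<times> complex})"
  have C: "(\<integral>\<^sup>+x. g (zonal x) \<partial>m_U) = C * (\<integral>\<^sup>+z. g z * indicator {-1..1} z \<partial>lborel)"
    if [measurable]: "g \<in> borel_measurable borel" for g
  proof -
    have "(\<lambda>x. g (zonal x)) \<in> borel_measurable (restrict_space borel SU2)"
      by (rule measurable_restrict_space1) measurable
    then show ?thesis
      unfolding m_U_eq
      by (simp add: nn_integral_sphere_measure nn_integral_sphere_zonal C_def divide_ennreal_def mult_ac)
  qed
  \<comment> \<open>None of the volumes in \<open>C\<close> has to be evaluated: total mass one
    fixes the constant, since [-1, 1] has length 2.\<close>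
  have "1 = C * 2"
    using C[of "\<lambda>_. 1"] prob_space.emeasure_space_1[OF prob_space_m_U] by simp
  then have "C = 1 / 2"
    using mult_divide_eq_ennreal[of 2 C] by simp
  then show ?thesis
    using C[OF assms] by (simp add: divide_ennreal_def mult.commute)
qed

text \<open>The arcsine density on [2c^2 - 1, 1] with respect to dz is 1 / (pi * sqrt ((1 - z) (z -
  (2c^2 - 1)))). The numerator is 2 because the density is taken relative to dz/2.\<close>

definition convolution_density :: "real \<Rightarrow> real \<Rightarrow> real" where
  "convolution_density c z = (if 2 * c\<^sup>2 - 1 < z \<and> z < 1 then 2 / (pi * sqrt ((1 - z) * (z - (2 * c\<^sup>2 - 1)))) else 0)"

lemma borel_measurable_convolution_density [measurable]: "convolution_density c \<in> borel_measurable borel"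
  unfolding convolution_density_def[abs_def] by measurable

text \<open>The function cos (2 * t) has period pi and is symmetric about pi / 2, so the circle
  consists of four copies of one quarter, up to endpoints of measure zero. On that quarter it is
  monotone, as the substitution that follows requires.\<close>

lemma nn_integral_cos_fold:
  fixes \<Phi> :: "real \<Rightarrow> ennreal"
  assumes [measurable]: "\<Phi> \<in> borel_measurable borel"
  shows "(\<integral>\<^sup>+t. \<Phi> (cos (2 * t)) * indicator {0..<2 * pi} t \<partial>lborel)
    = 4 * (\<integral>\<^sup>+t. \<Phi> (cos (2 * t)) * indicator {0..pi / 2} t \<partial>lborel)"
proof -
  let ?W = "\<lambda>t. \<Phi> (cos (2 * t))"
  let ?J = "\<lambda>A. (\<integral>\<^sup>+t. ?W t * indicator A t \<partial>lborel)"
  have AE: "?J A = ?J B" if "A - N = B - N" "finite N" and [measurable]: "A \<in> sets borel" "B \<in> sets borel" for A B N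
  proof (rule nn_integral_cong_AE)
    have "AE t in lborel. t \<notin> N"
      using that(2) by (intro AE_not_in) (simp add: finite_imp_null_set_lborel)
    then show "AE t in lborel. ?W t * indicator A t = ?W t * indicator B t"
      by eventually_elim (use that(1) in \<open>auto simp: indicator_def\<close>)
  qed
  have split: "?J {a..<c} = ?J {a..<b} + ?J {b..<c}" if "a \<le> b" "b \<le> c" for a b c :: real
  proof -
    have "?J {a..<c} = (\<integral>\<^sup>+t. ?W t * indicator {a..<b} t + ?W t * indicator {b..<c} t \<partial>lborel)"
      using that by (intro nn_integral_cong) (auto simp: indicator_def)
    then show ?thesis by (simp add: nn_integral_add)
  qed
  have "?J {pi..<2 * pi} = (\<integral>\<^sup>+t. ?W (pi + t) * indicator {pi..<2 * pi} (pi + t) \<partial>lborel)"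
    by (rule nn_integral_lborel_translate[symmetric]) measurable
  also have "\<dots> = ?J {0..<pi}"
    by (intro nn_integral_cong) (auto simp: indicator_def distrib_left cos_add)
  finally have 1: "?J {pi..<2 * pi} = ?J {0..<pi}" .
  have "?J {pi/2..<pi} = ennreal \<bar>-1\<bar> * (\<integral>\<^sup>+t. ?W (pi + -1 * t) * indicator {pi/2..<pi} (pi + -1 * t) \<partial>lborel)"
    by (rule nn_integral_real_affine) auto
  also have "\<dots> = ?J {0<..pi/2}"
    by (simp, intro nn_integral_cong) (auto simp: indicator_def algebra_simps cos_diff)
  also have "\<dots> = ?J {0..<pi/2}"
    by (rule AE[where N = "{0, pi/2}"]) auto
  finally have 2: "?J {pi/2..<pi} = ?J {0..<pi/2}" .
  have 3: "?J {0..<pi/2} = ?J {0..pi/2}"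
    by (rule AE[where N = "{pi/2}"]) auto
  have "x + x + (x + x) = 4 * x" for x :: ennreal
    by (simp flip: mult_2 mult.assoc)
  then show ?thesis
    using split[of 0 pi "2 * pi"] split[of 0 "pi/2" pi] 1 2 3 by simp
qed

text \<open>Along z = c^2 - (1 - c^2) cos 2t the root in the density equals (1 - c^2) sin 2t, half
  the derivative of the substitution. Their product is therefore the constant 4 / pi.\<close>

lemma arcsine_substitution:
  fixes \<Phi> :: "real \<Rightarrow> ennreal"
  assumes [measurable]: "\<Phi> \<in> borel_measurable borel" and c: "\<bar>c\<bar> < 1"
  shows "(\<integral>\<^sup>+t. \<Phi> (c\<^sup>2 - (1 - c\<^sup>2) * cos (2 * t)) * indicator {0..pi / 2} t \<partial>lborel) * ennreal (4 / pi)
    = (\<integral>\<^sup>+z. \<Phi> z * ennreal (convolution_density c z) * indicator {-1..1} z \<partial>lborel)"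
proof -
  have c1: "c\<^sup>2 < 1" using c by (simp add: abs_square_less_1)
  define g where "g = (\<lambda>t. c\<^sup>2 - (1 - c\<^sup>2) * cos (2 * t))"
  define g' where "g' = (\<lambda>t. 2 * (1 - c\<^sup>2) * sin (2 * t))"
  have g0: "g 0 = 2 * c\<^sup>2 - 1" and g1: "g (pi / 2) = 1"
    by (simp_all add: g_def)
  have "(\<integral>\<^sup>+z. \<Phi> z * ennreal (convolution_density c z) * indicator {-1..1} z \<partial>lborel)
      = (\<integral>\<^sup>+z. \<Phi> z * ennreal (convolution_density c z) * indicator {g 0..g (pi / 2)} z \<partial>lborel)"
  proof (intro nn_integral_cong)
    fix z :: real
    show "\<Phi> z * ennreal (convolution_density c z) * indicator {-1..1} z
        = \<Phi> z * ennreal (convolution_density c z) * indicator {g 0..g (pi / 2)} z"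
    proof (cases "2 * c\<^sup>2 - 1 < z")
      case True
      then have "-1 \<le> z" using zero_le_power2[of c] by linarith
      then show ?thesis using True by (simp add: g0 g1 indicator_def)
    qed (simp add: convolution_density_def)
  qed
  also have "\<dots> = (\<integral>\<^sup>+t. \<Phi> (g t) * ennreal (convolution_density c (g t)) * ennreal (g' t) * indicator {0..pi / 2} t \<partial>lborel)"
  proof (rule nn_integral_substitution_aux)
    show "(g has_real_derivative g' t) (at t)" for t
      unfolding g_def g'_def by (auto intro!: derivative_eq_intros)
    show "continuous_on {0..pi / 2} g'"
      unfolding g'_def by (intro continuous_intros)
    show "0 \<le> g' t" if "t \<in> {0..pi / 2}" for t
      using that c1 by (auto simp: g'_def intro!: mult_nonneg_nonneg sin_ge_zero)
  qed auto
  also have "\<dots> = (\<integral>\<^sup>+t. \<Phi> (g t) * indicator {0..pi / 2} t * ennreal (4 / pi) \<partial>lborel)"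
  proof (rule nn_integral_cong_AE)
    \<comment> \<open>At both ends the density has its default value 0, so the integrands may differ
      there.\<close>
    have "AE t in lborel. t \<notin> {0, pi / 2}"
      by (intro AE_not_in) (simp add: finite_imp_null_set_lborel)
    then show "AE t in lborel. \<Phi> (g t) * ennreal (convolution_density c (g t)) * ennreal (g' t) * indicator {0..pi / 2} t
        = \<Phi> (g t) * indicator {0..pi / 2} t * ennreal (4 / pi)"
    proof eventually_elim
      fix t :: real assume t: "t \<notin> {0, pi / 2}"
      show "\<Phi> (g t) * ennreal (convolution_density c (g t)) * ennreal (g' t) * indicator {0..pi / 2} t
        = \<Phi> (g t) * indicator {0..pi / 2} t * ennreal (4 / pi)"
      proof (cases "t \<in> {0..pi / 2}")
        case True
        have sin: "0 < sin (2 * t)"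
          using t True by (intro sin_gt_zero) auto
        then have "cos (2 * t) \<noteq> 1" "cos (2 * t) \<noteq> -1"
          using sin_squared_eq[of "2 * t"] by auto
        then have "cos (2 * t) < 1" "-1 < cos (2 * t)"
          using cos_le_one[of "2 * t"] cos_ge_minus_one[of "2 * t"] by linarith+
        then have pos: "0 < (1 - c\<^sup>2) * (1 + cos (2 * t))" "0 < (1 - c\<^sup>2) * (1 - cos (2 * t))"
          using c1 by simp_all
        have e: "1 - g t = (1 - c\<^sup>2) * (1 + cos (2 * t))" "g t - (2 * c\<^sup>2 - 1) = (1 - c\<^sup>2) * (1 - cos (2 * t))"
          by (simp_all add: g_def algebra_simps)
        have "(1 - g t) * (g t - (2 * c\<^sup>2 - 1)) = (1 - c\<^sup>2)\<^sup>2 * (1 - (cos (2 * t))\<^sup>2)"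
          unfolding e by (simp add: power2_eq_square algebra_simps)
        also have "\<dots> = ((1 - c\<^sup>2) * sin (2 * t))\<^sup>2"
          by (simp add: power_mult_distrib sin_squared_eq)
        finally have "sqrt ((1 - g t) * (g t - (2 * c\<^sup>2 - 1))) = (1 - c\<^sup>2) * sin (2 * t)"
          using sin c1 by simp
        then have "convolution_density c (g t) = 2 / (pi * ((1 - c\<^sup>2) * sin (2 * t)))"
          using pos unfolding e[symmetric] by (simp add: convolution_density_def)
        then have "convolution_density c (g t) * g' t = 4 / pi"
          using sin c1 by (simp add: g'_def field_simps)
        moreover have "0 \<le> convolution_density c (g t)" "0 \<le> g' t"
          using sin c1 by (simp_all add: convolution_density_def g'_def)
        ultimately have "ennreal (convolution_density c (g t)) * ennreal (g' t) = ennreal (4 / pi)"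
          by (simp flip: ennreal_mult)
        then show ?thesis
          using True by (simp add: mult.assoc)
      qed simp
    qed
  qed
  also have "\<dots> = (\<integral>\<^sup>+t. \<Phi> (g t) * indicator {0..pi / 2} t \<partial>lborel) * ennreal (4 / pi)"
    by (intro nn_integral_multc) (simp add: g_def)
  finally show ?thesis
    by (simp add: g_def)
qed

lemma nn_integral_m_K_zonal:
  fixes \<Phi> :: "real \<Rightarrow> ennreal"
  assumes [measurable]: "\<Phi> \<in> borel_measurable borel" and c: "\<bar>c\<bar> < 1"
  shows "(\<integral>\<^sup>+k. \<Phi> (zonal (diag c ** k ** diag c)) \<partial>m_K)
    = (\<integral>\<^sup>+x. \<Phi> (zonal x) * ennreal (convolution_density c (zonal x)) \<partial>m_U)"
proof -
  have [measurable]: "(\<lambda>k. diag c ** k ** diag c) \<in> borel_measurable borel"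
    by (intro measurable_matrix_mult) auto
  have "(\<lambda>k. \<Phi> (zonal (diag c ** k ** diag c))) \<in> borel_measurable borel"
    by measurable
  then have m: "(\<lambda>k. \<Phi> (zonal (diag c ** k ** diag c))) \<in> borel_measurable (restrict_space borel SO2)"
    by (rule measurable_restrict_space1)
  have "(\<integral>\<^sup>+k. \<Phi> (zonal (diag c ** k ** diag c)) \<partial>m_K)
     = (\<integral>\<^sup>+t. \<Phi> (c\<^sup>2 - (1 - c\<^sup>2) * cos (2 * t)) * indicator {0..<2 * pi} t \<partial>lborel) / ennreal (2 * pi)"
    using c unfolding m_K_eq nn_integral_circle_measure[OF m] by (simp add: zonal_diag_rot_diag)
  also have "\<dots> = (\<integral>\<^sup>+t. \<Phi> (c\<^sup>2 - (1 - c\<^sup>2) * cos (2 * t)) * indicator {0..pi / 2} t \<partial>lborel) * (4 / ennreal (2 * pi))"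
    using nn_integral_cos_fold[of "\<lambda>w. \<Phi> (c\<^sup>2 - (1 - c\<^sup>2) * w)"]
    by (simp add: divide_ennreal_def mult_ac)
  \<comment> \<open>Four quarters over the length 2 pi match the constant 4 / pi of the substitution
    times the factor 1/2 in dz/2.\<close>
  also have "4 / ennreal (2 * pi) = ennreal (4 / pi) / 2"
    by (simp add: divide_ennreal flip: ennreal_numeral)
  finally show ?thesis
    using nn_integral_m_U_zonal[of "\<lambda>z. \<Phi> z * ennreal (convolution_density c z)"]
      arcsine_substitution[OF assms]
    by (simp add: divide_ennreal_def flip: mult.assoc)
qed

section \<open>Double cosets and convolution\<close>

declare measurable_matrix_mult [measurable (raw)]

lemma borel_measurable_ctranspose [measurable (raw)]:
  fixes f :: "'a \<Rightarrow> complex^2^2"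
  assumes "f \<in> borel_measurable M"
  shows "(\<lambda>x. ctranspose (f x)) \<in> borel_measurable M"
proof -
  have "continuous_on UNIV (ctranspose :: complex^2^2 \<Rightarrow> _)"
    unfolding ctranspose_def by (intro continuous_intros)
  then show ?thesis
    using assms by (intro measurable_compose[OF assms] borel_measurable_continuous_onI)
qed

lemma borel_measurable_diag [measurable]: "diag \<in> borel_measurable borel"
proof -
  have "(\<lambda>w. Complex (sqrt ((1 + w) / 2)) (sqrt ((1 - w) / 2))) \<in> borel_measurable borel"
    by (intro borel_measurable_continuous_onI continuous_intros) auto
  from measurable_compose[OF _ this, of "\<lambda>z. max (-1) (min 1 z)" borel] show ?thesis
    unfolding diag_def[abs_def] Let_def by measurable
qed

text \<open>Extending a measure by zero from a closed group to the whole matrix space turns the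
  measurability of functions of several group elements into plain Borel measurability.\<close>

definition extend :: "(complex^2^2) measure \<Rightarrow> (complex^2^2) measure" where
  "extend M = distr M borel (\<lambda>x. x)"

lemma sets_extend [simp, measurable_cong]: "sets (extend M) = sets borel"
  by (simp add: extend_def)

lemma space_extend [simp]: "space (extend M) = UNIV"
  by (simp add: extend_def)

lemma prob_space_extend:
  "prob_space M \<Longrightarrow> sets M = sets (restrict_space borel S) \<Longrightarrow> prob_space (extend M)"
  unfolding extend_def by (intro prob_space.prob_space_distr measurable_restrict_borel_imp)

lemma nn_integral_extend:
  assumes "sets M = sets (restrict_space borel S)" and "h \<in> borel_measurable borel"
  shows "(\<integral>\<^sup>+x. h x \<partial>extend M) = (\<integral>\<^sup>+x. h x \<partial>M)"
  unfolding extend_def using assms by (simp add: nn_integral_distr measurable_restrict_borel_imp)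

lemma borel_measurable_restrict_sets:
  assumes "sets M = sets (restrict_space borel S)" and "h \<in> borel_measurable borel"
  shows "h \<in> borel_measurable M"
  using measurable_compose[OF measurable_restrict_borel_imp[OF assms(1)] assms(2)] .

lemma sets_SU2 [measurable]: "SU2 \<in> sets borel"
  by (intro borel_closed compact_imp_closed compact_SU2)

lemma sets_SO2 [measurable]: "SO2 \<in> sets borel"
proof -
  have *: "SO2 = SU2 \<inter> (\<Inter>i. \<Inter>j. {A. Im (A $ i $ j) = 0})"
    by (auto simp: SO2_def complex_is_Real_iff)
  have "closed {A :: complex^2^2. Im (A $ i $ j) = 0}" for i j
    by (intro closed_Collect_eq continuous_intros)
  then have "closed SO2"
    unfolding * by (intro closed_Int[OF compact_imp_closed[OF compact_SU2]] closed_INT ballI)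
  then show ?thesis by (rule borel_closed)
qed

lemma AE_extend:
  assumes M: "sets M = sets (restrict_space borel S)" and "S \<in> sets borel"
  shows "AE x in extend M. x \<in> S"
proof -
  have "AE x in M. x \<in> S"
    using sets_eq_imp_space_eq[OF M] by (intro AE_I2) (simp add: space_restrict_space)
  then show ?thesis
    unfolding extend_def using assms
    by (subst AE_distr_iff) (simp_all add: measurable_restrict_borel_imp)
qed

lemma measure_eqI_SU2:
  assumes M: "sets M = sets (restrict_space borel SU2)" and N: "sets N = sets (restrict_space borel SU2)"
    and eq: "\<And>h. h \<in> borel_measurable borel \<Longrightarrow> (\<integral>\<^sup>+x. h x \<partial>M) = (\<integral>\<^sup>+x. h x \<partial>N)"
  shows "M = N"
proof (rule measure_eqI)
  fix A assume A: "A \<in> sets M"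
  then have "A \<in> sets borel"
    unfolding M sets_restrict_space by auto
  then show "emeasure M A = emeasure N A"
    using eq[of "indicator A"] A M N by simp
qed (simp add: M N)

section \<open>Invariant integration with the extended Haar measures\<close>

abbreviation "eK \<equiv> extend m_K"
abbreviation "eU \<equiv> extend m_U"

interpretation eK: prob_space eK
  by (rule prob_space_extend[OF prob_space_m_K sets_m_K])

interpretation eU: prob_space eU
  by (rule prob_space_extend[OF prob_space_m_U sets_m_U])

lemma AE_eK: "AE k in eK. k \<in> SO2"
  by (rule AE_extend[OF sets_m_K sets_SO2])

lemma AE_eU: "AE k in eU. k \<in> SU2"
  by (rule AE_extend[OF sets_m_U sets_SU2])

lemma nn_integral_eK_cong: "(\<And>k. k \<in> SO2 \<Longrightarrow> f k = g k) \<Longrightarrow> (\<integral>\<^sup>+k. f k \<partial>eK) = (\<integral>\<^sup>+k. g k \<partial>eK)"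
  by (rule nn_integral_cong_AE) (use AE_eK in eventually_elim, simp)

lemma nn_integral_eU_cong: "(\<And>k. k \<in> SU2 \<Longrightarrow> f k = g k) \<Longrightarrow> (\<integral>\<^sup>+k. f k \<partial>eU) = (\<integral>\<^sup>+k. g k \<partial>eU)"
  by (rule nn_integral_cong_AE) (use AE_eU in eventually_elim, simp)

lemma nn_integral_eK_translate:
  assumes [measurable]: "h \<in> borel_measurable borel" and g: "g \<in> SO2"
  shows "(\<integral>\<^sup>+k. h (g ** k) \<partial>eK) = (\<integral>\<^sup>+k. h k \<partial>eK)" "(\<integral>\<^sup>+k. h (k ** g) \<partial>eK) = (\<integral>\<^sup>+k. h k \<partial>eK)"
  using g nn_integral_m_K_left[OF g borel_measurable_restrict_sets[OF sets_m_K assms(1)]]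
    nn_integral_m_K_right[OF g borel_measurable_restrict_sets[OF sets_m_K assms(1)]]
  by (simp_all add: nn_integral_extend[OF sets_m_K])

lemma nn_integral_eU_translate:
  assumes [measurable]: "h \<in> borel_measurable borel" and g: "g \<in> SU2"
  shows "(\<integral>\<^sup>+k. h (g ** k) \<partial>eU) = (\<integral>\<^sup>+k. h k \<partial>eU)" "(\<integral>\<^sup>+k. h (k ** g) \<partial>eU) = (\<integral>\<^sup>+k. h k \<partial>eU)"
  using g nn_integral_m_U_left[OF g borel_measurable_restrict_sets[OF sets_m_U assms(1)]]
    nn_integral_m_U_right[OF g borel_measurable_restrict_sets[OF sets_m_U assms(1)]]
  by (simp_all add: nn_integral_extend[OF sets_m_U])

lemma nn_integral_swap:
  assumes "prob_space M" "prob_space N" "sets M = sets borel" "sets N = sets borel"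
    and [measurable]: "case_prod f \<in> borel_measurable (borel \<Otimes>\<^sub>M borel)"
  shows "(\<integral>\<^sup>+x. (\<integral>\<^sup>+y. f x y \<partial>N) \<partial>M) = (\<integral>\<^sup>+y. (\<integral>\<^sup>+x. f x y \<partial>M) \<partial>N)"
proof -
  interpret M: prob_space M by fact
  interpret N: prob_space N by fact
  interpret pair_prob_space M N ..
  have "case_prod f \<in> borel_measurable (M \<Otimes>\<^sub>M N)"
    using assms by (simp add: measurable_cong_sets[OF sets_pair_measure_cong[OF assms(3,4)] refl])
  from Fubini'[OF this] show ?thesis by simp
qed

text \<open>The function h (k^-1 l) is averaged over k and l. For fixed l, replacing k by l^-1 k in
  the integral of h (k^-1) introduces l; for fixed k, left invariance in l removes k.\<close>

lemma nn_integral_eK_inverse: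
  assumes [measurable]: "h \<in> borel_measurable borel"
  shows "(\<integral>\<^sup>+k. h (ctranspose k) \<partial>eK) = (\<integral>\<^sup>+k. h k \<partial>eK)"
proof -
  have SO2_ct: "ctranspose k \<in> SO2" if "k \<in> SO2" for k
    using that by (auto simp: SO2_def ctranspose_in_SU2) (simp add: ctranspose_def complex_is_Real_iff)
  have ct: "ctranspose (ctranspose k) = k" for k :: "complex^2^2"
    by (simp add: ctranspose_def vec_eq_iff)
  have "(\<integral>\<^sup>+k. h (ctranspose k) \<partial>eK) = (\<integral>\<^sup>+l. (\<integral>\<^sup>+k. h (ctranspose k) \<partial>eK) \<partial>eK)"
    by (simp add: eK.emeasure_space_1[simplified])
  also have "\<dots> = (\<integral>\<^sup>+l. (\<integral>\<^sup>+k. h (ctranspose k ** l) \<partial>eK) \<partial>eK)"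
  proof (rule nn_integral_eK_cong)
    fix l assume "l \<in> SO2"
    then show "(\<integral>\<^sup>+k. h (ctranspose k) \<partial>eK) = (\<integral>\<^sup>+k. h (ctranspose k ** l) \<partial>eK)"
      using nn_integral_eK_translate(1)[of "\<lambda>k. h (ctranspose k)" "ctranspose l"]
      by (simp add: SO2_ct ctranspose_mult ct)
  qed
  also have "\<dots> = (\<integral>\<^sup>+k. (\<integral>\<^sup>+l. h (ctranspose k ** l) \<partial>eK) \<partial>eK)"
    by (rule nn_integral_swap) (auto intro: eK.prob_space_axioms)
  also have "\<dots> = (\<integral>\<^sup>+k. (\<integral>\<^sup>+l. h l \<partial>eK) \<partial>eK)"
    by (intro nn_integral_eK_cong nn_integral_eK_translate(1) SO2_ct) auto
  also have "\<dots> = (\<integral>\<^sup>+l. h l \<partial>eK)"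
    by (simp add: eK.emeasure_space_1[simplified])
  finally show ?thesis .
qed

section \<open>Measures on double cosets and their convolutions\<close>

abbreviation "\<mu> a \<equiv> double_coset_measure m_K a"

lemma sets_double_coset_measure: "sets (double_coset_measure M a) = sets (restrict_space borel SU2)"
  by (simp add: double_coset_measure_def)

lemma sets_mconv: "sets (mconv M N) = sets (restrict_space borel SU2)"
  by (simp add: mconv_def)

lemma measurable_SU2_pair:
  assumes M: "sets M = sets (restrict_space borel S)" and N: "sets N = sets (restrict_space borel S)"
    and f: "f \<in> borel_measurable (borel \<Otimes>\<^sub>M borel)" and SU2: "\<And>x y. x \<in> S \<Longrightarrow> y \<in> S \<Longrightarrow> f (x, y) \<in> SU2"
  shows "f \<in> measurable (M \<Otimes>\<^sub>M N) (restrict_space borel SU2)"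
proof (rule measurable_restrict_space2)
  have [measurable]: "(\<lambda>x. x) \<in> borel_measurable M" "(\<lambda>x. x) \<in> borel_measurable N"
    using M N by (auto intro: measurable_restrict_borel_imp)
  have "(\<lambda>p. (fst p, snd p)) \<in> measurable (M \<Otimes>\<^sub>M N) (borel \<Otimes>\<^sub>M borel)"
    by (intro measurable_Pair measurable_compose[OF measurable_fst] measurable_compose[OF measurable_snd]) measurable
  from measurable_compose[OF this f] show "f \<in> borel_measurable (M \<Otimes>\<^sub>M N)"
    by simp
  show "f \<in> space (M \<Otimes>\<^sub>M N) \<rightarrow> SU2"
    using sets_eq_imp_space_eq[OF M] sets_eq_imp_space_eq[OF N] SU2
    by (auto simp: space_pair_measure space_restrict_space)
qed

lemma nn_integral_pair_extend:
  assumes "prob_space M" "prob_space N"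
    and M: "sets M = sets (restrict_space borel S)" and N: "sets N = sets (restrict_space borel T)"
    and [measurable]: "f \<in> borel_measurable (borel \<Otimes>\<^sub>M borel)"
  shows "(\<integral>\<^sup>+p. f p \<partial>(M \<Otimes>\<^sub>M N)) = (\<integral>\<^sup>+x. (\<integral>\<^sup>+y. f (x, y) \<partial>extend N) \<partial>extend M)"
proof -
  interpret M: prob_space M by fact
  interpret N: prob_space N by fact
  interpret eN: prob_space "extend N" by (rule prob_space_extend) fact+
  have idM: "(\<lambda>x. x) \<in> borel_measurable M" and idN: "(\<lambda>x. x) \<in> borel_measurable N"
    using M N by (auto intro: measurable_restrict_borel_imp)
  have "(\<lambda>p. (fst p, snd p)) \<in> measurable (M \<Otimes>\<^sub>M N) (borel \<Otimes>\<^sub>M borel)"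
    by (intro measurable_Pair measurable_compose[OF measurable_fst idM] measurable_compose[OF measurable_snd idN])
  from measurable_compose[OF this assms(5)] have "f \<in> borel_measurable (M \<Otimes>\<^sub>M N)"
    by simp
  then have "(\<integral>\<^sup>+p. f p \<partial>(M \<Otimes>\<^sub>M N)) = (\<integral>\<^sup>+x. (\<integral>\<^sup>+y. f (x, y) \<partial>N) \<partial>M)"
    by (rule N.nn_integral_fst[symmetric])
  also have "\<dots> = (\<integral>\<^sup>+x. (\<integral>\<^sup>+y. f (x, y) \<partial>extend N) \<partial>M)"
    by (simp add: nn_integral_extend[OF N])
  also have "\<dots> = (\<integral>\<^sup>+x. (\<integral>\<^sup>+y. f (x, y) \<partial>extend N) \<partial>extend M)"
    by (rule nn_integral_extend[OF M, symmetric]) measurable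
  finally show ?thesis .
qed

lemma measurable_double_coset:
  "a \<in> SU2 \<Longrightarrow> (\<lambda>(k1, k2). k1 ** a ** k2) \<in> measurable (m_K \<Otimes>\<^sub>M m_K) (restrict_space borel SU2)"
  using SO2_subset_SU2 by (intro measurable_SU2_pair[OF sets_m_K sets_m_K]) (auto intro!: SU2_mult)

lemma nn_integral_double_coset:
  assumes [measurable]: "h \<in> borel_measurable borel" and a: "a \<in> SU2"
  shows "(\<integral>\<^sup>+x. h x \<partial>\<mu> a) = (\<integral>\<^sup>+k. (\<integral>\<^sup>+l. h (k ** a ** l) \<partial>eK) \<partial>eK)"
proof -
  have "h \<in> borel_measurable (restrict_space borel SU2)"
    by (rule measurable_restrict_space1) fact
  then have "(\<integral>\<^sup>+x. h x \<partial>\<mu> a) = (\<integral>\<^sup>+p. h (fst p ** a ** snd p) \<partial>(m_K \<Otimes>\<^sub>M m_K))"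
    unfolding double_coset_measure_def
    using measurable_double_coset[OF a] by (simp add: nn_integral_distr case_prod_unfold)
  also have "\<dots> = (\<integral>\<^sup>+k. (\<integral>\<^sup>+l. h (k ** a ** l) \<partial>eK) \<partial>eK)"
    by (subst nn_integral_pair_extend[OF prob_space_m_K prob_space_m_K sets_m_K sets_m_K]) auto
  finally show ?thesis .
qed

lemma prob_space_double_coset_measure:
  assumes "a \<in> SU2"
  shows "prob_space (\<mu> a)"
proof -
  interpret K: prob_space m_K by (rule prob_space_m_K)
  interpret pair_prob_space m_K m_K ..
  show ?thesis
    unfolding double_coset_measure_def by (rule prob_space_distr[OF measurable_double_coset[OF assms]])
qed

lemma nn_integral_mconv:
  assumes M: "prob_space M" "sets M = sets (restrict_space borel SU2)"
    and N: "prob_space N" "sets N = sets (restrict_space borel SU2)"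
    and [measurable]: "h \<in> borel_measurable borel"
  shows "(\<integral>\<^sup>+x. h x \<partial>mconv M N) = (\<integral>\<^sup>+x. (\<integral>\<^sup>+y. h (x ** y) \<partial>extend N) \<partial>extend M)"
proof -
  have h: "h \<in> borel_measurable (restrict_space borel SU2)"
    by (rule measurable_restrict_space1) fact
  have mult: "(\<lambda>(x, y). x ** y) \<in> measurable (M \<Otimes>\<^sub>M N) (restrict_space borel SU2)"
    by (rule measurable_SU2_pair[OF M(2) N(2)]) (auto intro!: SU2_mult)
  have "(\<integral>\<^sup>+x. h x \<partial>mconv M N) = (\<integral>\<^sup>+p. h (fst p ** snd p) \<partial>(M \<Otimes>\<^sub>M N))"
    unfolding mconv_def using h mult by (simp add: nn_integral_distr case_prod_unfold)
  also have "\<dots> = (\<integral>\<^sup>+x. (\<integral>\<^sup>+y. h (x ** y) \<partial>extend N) \<partial>extend M)"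
    by (subst nn_integral_pair_extend[OF M(1) N(1) M(2) N(2)]) auto
  finally show ?thesis .
qed

lemma prob_space_mconv:
  assumes M: "prob_space M" "sets M = sets (restrict_space borel SU2)"
    and N: "prob_space N" "sets N = sets (restrict_space borel SU2)"
  shows "prob_space (mconv M N)"
proof -
  interpret M: prob_space M by fact
  interpret N: prob_space N by fact
  interpret pair_prob_space M N ..
  have "(\<lambda>(x, y). x ** y) \<in> measurable (M \<Otimes>\<^sub>M N) (restrict_space borel SU2)"
    by (rule measurable_SU2_pair[OF M(2) N(2)]) (auto intro!: SU2_mult)
  then show ?thesis
    unfolding mconv_def by (rule prob_space_distr)
qed

lemma double_coset_measure_biinvariant:
  assumes a: "a \<in> SU2" and k: "k \<in> SO2" and l: "l \<in> SO2"
  shows "\<mu> (k ** a ** l) = \<mu> a"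
proof (rule measure_eqI_SU2[OF sets_double_coset_measure sets_double_coset_measure])
  fix h :: "complex^2^2 \<Rightarrow> ennreal" assume [measurable]: "h \<in> borel_measurable borel"
  have kal: "k ** a ** l \<in> SU2"
    using assms SO2_subset_SU2 by (auto intro!: SU2_mult)
  have "(\<integral>\<^sup>+x. h x \<partial>\<mu> (k ** a ** l)) = (\<integral>\<^sup>+p. (\<integral>\<^sup>+q. h (p ** k ** a ** (l ** q)) \<partial>eK) \<partial>eK)"
    by (simp add: nn_integral_double_coset kal matrix_mul_assoc)
  also have "\<dots> = (\<integral>\<^sup>+p. (\<integral>\<^sup>+q. h (p ** k ** a ** q) \<partial>eK) \<partial>eK)"
    by (intro nn_integral_cong nn_integral_eK_translate(1) l) measurable
  also have "\<dots> = (\<integral>\<^sup>+p. (\<integral>\<^sup>+q. h (p ** a ** q) \<partial>eK) \<partial>eK)"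
    by (rule nn_integral_eK_translate(2)[of "\<lambda>p. \<integral>\<^sup>+q. h (p ** a ** q) \<partial>eK"]) (use k in measurable)
  also have "\<dots> = (\<integral>\<^sup>+x. h x \<partial>\<mu> a)"
    by (simp add: nn_integral_double_coset a)
  finally show "(\<integral>\<^sup>+x. h x \<partial>\<mu> (k ** a ** l)) = (\<integral>\<^sup>+x. h x \<partial>\<mu> a)" .
qed

text \<open>The outer factors of the Cartan decomposition are absorbed by the Haar integrals over K,
  so only the height of \<open>a\<close> is left.\<close>

lemma double_coset_measure_diag:
  assumes "a \<in> SU2"
  shows "\<mu> a = \<mu> (diag (zonal a))"
proof -
  obtain k l where "k \<in> SO2" "l \<in> SO2" "a = k ** diag (zonal a) ** l"
    using assms by (rule KAK_decomposition)
  then show ?thesis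
    using double_coset_measure_biinvariant[OF diag_in_SU2] by metis
qed

text \<open>Inversion carries the measure of \<open>a\<close> to that of its inverse. The inverse
  has the same height and hence lies in the same double coset.\<close>

lemma nn_integral_double_coset_inverse:
  assumes [measurable]: "h \<in> borel_measurable borel" and a: "a \<in> SU2"
  shows "(\<integral>\<^sup>+x. h (ctranspose x) \<partial>\<mu> a) = (\<integral>\<^sup>+x. h x \<partial>\<mu> a)"
proof -
  have "(\<integral>\<^sup>+x. h (ctranspose x) \<partial>\<mu> a)
      = (\<integral>\<^sup>+k. (\<integral>\<^sup>+l. h (ctranspose l ** ctranspose a ** ctranspose k) \<partial>eK) \<partial>eK)"
    by (simp add: nn_integral_double_coset a ctranspose_mult matrix_mul_assoc)
  also have "\<dots> = (\<integral>\<^sup>+k. (\<integral>\<^sup>+l. h (l ** ctranspose a ** ctranspose k) \<partial>eK) \<partial>eK)"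
    by (intro nn_integral_cong nn_integral_eK_inverse) measurable
  also have "\<dots> = (\<integral>\<^sup>+k. (\<integral>\<^sup>+l. h (l ** ctranspose a ** k) \<partial>eK) \<partial>eK)"
    by (rule nn_integral_eK_inverse[of "\<lambda>k. \<integral>\<^sup>+l. h (l ** ctranspose a ** k) \<partial>eK"]) measurable
  also have "\<dots> = (\<integral>\<^sup>+l. (\<integral>\<^sup>+k. h (l ** ctranspose a ** k) \<partial>eK) \<partial>eK)"
    by (rule nn_integral_swap) (auto intro: eK.prob_space_axioms)
  also have "\<dots> = (\<integral>\<^sup>+x. h x \<partial>\<mu> (ctranspose a))"
    by (simp add: nn_integral_double_coset a ctranspose_in_SU2)
  also have "\<mu> (ctranspose a) = \<mu> a"
    using double_coset_measure_diag[OF a] double_coset_measure_diag[OF ctranspose_in_SU2[OF a]]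
    by (simp add: zonal_ctranspose a)
  finally show ?thesis .
qed

text \<open>Averaging Haar measure over translations by K on both sides does not change it. The
  resulting mixture of double coset measures leads from functions of the height back to arbitrary
  test functions.\<close>

lemma nn_integral_m_U_disintegrate:
  assumes [measurable]: "h \<in> borel_measurable borel"
  shows "(\<integral>\<^sup>+x. h x \<partial>eU) = (\<integral>\<^sup>+x. (\<integral>\<^sup>+y. h y \<partial>\<mu> x) \<partial>eU)"
proof -
  have "(\<integral>\<^sup>+x. (\<integral>\<^sup>+y. h y \<partial>\<mu> x) \<partial>eU) = (\<integral>\<^sup>+x. (\<integral>\<^sup>+k. (\<integral>\<^sup>+l. h (k ** x ** l) \<partial>eK) \<partial>eK) \<partial>eU)"
    by (rule nn_integral_eU_cong) (simp add: nn_integral_double_coset)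
  also have "\<dots> = (\<integral>\<^sup>+k. (\<integral>\<^sup>+x. (\<integral>\<^sup>+l. h (k ** x ** l) \<partial>eK) \<partial>eU) \<partial>eK)"
    by (rule nn_integral_swap) (auto intro: eK.prob_space_axioms eU.prob_space_axioms)
  also have "\<dots> = (\<integral>\<^sup>+k. (\<integral>\<^sup>+l. (\<integral>\<^sup>+x. h (k ** x ** l) \<partial>eU) \<partial>eK) \<partial>eK)"
    by (intro nn_integral_cong nn_integral_swap) (auto intro: eK.prob_space_axioms eU.prob_space_axioms)
  also have "\<dots> = (\<integral>\<^sup>+k. (\<integral>\<^sup>+l. (\<integral>\<^sup>+x. h x \<partial>eU) \<partial>eK) \<partial>eK)"
  proof (intro nn_integral_eK_cong)
    fix k l assume "k \<in> SO2" "l \<in> SO2"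
    then have "k \<in> SU2" "l \<in> SU2" using SO2_subset_SU2 by auto
    then show "(\<integral>\<^sup>+x. h (k ** x ** l) \<partial>eU) = (\<integral>\<^sup>+x. h x \<partial>eU)"
      using nn_integral_eU_translate(1)[of "\<lambda>x. h (x ** l)" k] nn_integral_eU_translate(2)[of h l] by simp
  qed
  also have "\<dots> = (\<integral>\<^sup>+x. h x \<partial>eU)"
    by (simp add: eK.emeasure_space_1[simplified])
  finally show ?thesis ..
qed

text \<open>Of the four integrations over K, the two between \<open>a\<close> and \<open>b\<close>
  merge into one by translation invariance. The other two reassemble the measure of the double coset
  of a k b.\<close>

lemma nn_integral_mconv_double_coset:
  assumes [measurable]: "h \<in> borel_measurable borel" and a: "a \<in> SU2" and b: "b \<in> SU2"
  shows "(\<integral>\<^sup>+x. h x \<partial>mconv (\<mu> a) (\<mu> b)) = (\<integral>\<^sup>+k. (\<integral>\<^sup>+x. h x \<partial>\<mu> (a ** k ** b)) \<partial>eK)"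
proof -
  note prob = prob_space_double_coset_measure
  have ext: "(\<integral>\<^sup>+x. g x \<partial>extend (\<mu> c)) = (\<integral>\<^sup>+x. g x \<partial>\<mu> c)" if "g \<in> borel_measurable borel" for g c
    by (rule nn_integral_extend[OF sets_double_coset_measure that])
  interpret eb: prob_space "extend (\<mu> b)"
    by (rule prob_space_extend[OF prob[OF b] sets_double_coset_measure])
  have "(\<integral>\<^sup>+x. h x \<partial>mconv (\<mu> a) (\<mu> b)) = (\<integral>\<^sup>+x. (\<integral>\<^sup>+y. h (x ** y) \<partial>extend (\<mu> b)) \<partial>extend (\<mu> a))"
    by (rule nn_integral_mconv[OF prob[OF a] sets_double_coset_measure prob[OF b] sets_double_coset_measure]) fact
  also have "\<dots> = (\<integral>\<^sup>+x. (\<integral>\<^sup>+y. h (x ** y) \<partial>extend (\<mu> b)) \<partial>\<mu> a)"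
    by (rule ext) measurable
  also have "\<dots> = (\<integral>\<^sup>+k. (\<integral>\<^sup>+l. (\<integral>\<^sup>+y. h (k ** a ** l ** y) \<partial>extend (\<mu> b)) \<partial>eK) \<partial>eK)"
    by (rule nn_integral_double_coset[OF _ a]) measurable
  also have "\<dots> = (\<integral>\<^sup>+k. (\<integral>\<^sup>+l. (\<integral>\<^sup>+p. (\<integral>\<^sup>+q. h (k ** a ** (l ** p) ** b ** q) \<partial>eK) \<partial>eK) \<partial>eK) \<partial>eK)"
    by (simp add: ext nn_integral_double_coset b matrix_mul_assoc)
  also have "\<dots> = (\<integral>\<^sup>+k. (\<integral>\<^sup>+l. (\<integral>\<^sup>+p. (\<integral>\<^sup>+q. h (k ** a ** p ** b ** q) \<partial>eK) \<partial>eK) \<partial>eK) \<partial>eK)"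
    by (intro nn_integral_cong[of eK] nn_integral_eK_cong
      nn_integral_eK_translate(1)[of "\<lambda>p. \<integral>\<^sup>+q. h (_ ** a ** p ** b ** q) \<partial>eK"]) measurable
  also have "\<dots> = (\<integral>\<^sup>+k. (\<integral>\<^sup>+p. (\<integral>\<^sup>+q. h (k ** a ** p ** b ** q) \<partial>eK) \<partial>eK) \<partial>eK)"
    by (simp add: eK.emeasure_space_1[simplified])
  also have "\<dots> = (\<integral>\<^sup>+p. (\<integral>\<^sup>+k. (\<integral>\<^sup>+q. h (k ** a ** p ** b ** q) \<partial>eK) \<partial>eK) \<partial>eK)"
    by (rule nn_integral_swap) (auto intro: eK.prob_space_axioms)
  also have "\<dots> = (\<integral>\<^sup>+k. (\<integral>\<^sup>+x. h x \<partial>\<mu> (a ** k ** b)) \<partial>eK)"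
  proof (rule nn_integral_eK_cong)
    fix p assume "p \<in> SO2"
    then have "a ** p ** b \<in> SU2"
      using a b SO2_subset_SU2 by (auto intro!: SU2_mult)
    then show "(\<integral>\<^sup>+k. (\<integral>\<^sup>+q. h (k ** a ** p ** b ** q) \<partial>eK) \<partial>eK) = (\<integral>\<^sup>+x. h x \<partial>\<mu> (a ** p ** b))"
      by (simp add: nn_integral_double_coset matrix_mul_assoc)
  qed
  finally show ?thesis .
qed

lemma mconv_double_coset_density:
  assumes a: "a \<in> SU2" and z: "\<bar>zonal a\<bar> < 1"
  shows "mconv (\<mu> a) (\<mu> a) = density m_U (\<lambda>x. ennreal (convolution_density (zonal a) (zonal x)))"
    (is "_ = density m_U ?f")
proof (rule measure_eqI_SU2[OF sets_mconv])
  show "sets (density m_U ?f) = sets (restrict_space borel SU2)"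
    by (simp add: sets_m_U)
  fix h :: "complex^2^2 \<Rightarrow> ennreal" assume [measurable]: "h \<in> borel_measurable borel"
  define c where "c = zonal a"
  \<comment> \<open>This is the average of h over the double coset of height z. All that matters
    about a k a is then its height.\<close>
  define \<Phi> where "\<Phi> = (\<lambda>z. \<integral>\<^sup>+k. (\<integral>\<^sup>+l. h (k ** diag z ** l) \<partial>eK) \<partial>eK)"
  have [measurable]: "\<Phi> \<in> borel_measurable borel"
    unfolding \<Phi>_def by measurable
  have \<Phi>: "(\<integral>\<^sup>+y. h y \<partial>\<mu> x) = \<Phi> (zonal x)" if "x \<in> SU2" for x
    unfolding double_coset_measure_diag[OF that] \<Phi>_def
    by (rule nn_integral_double_coset[OF _ diag_in_SU2]) fact
  have "(\<integral>\<^sup>+x. h x \<partial>mconv (\<mu> a) (\<mu> a)) = (\<integral>\<^sup>+x. h x \<partial>mconv (\<mu> (diag c)) (\<mu> (diag c)))"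
    by (simp add: double_coset_measure_diag[OF a] c_def)
  also have "\<dots> = (\<integral>\<^sup>+k. (\<integral>\<^sup>+x. h x \<partial>\<mu> (diag c ** k ** diag c)) \<partial>eK)"
    by (rule nn_integral_mconv_double_coset) (auto intro: diag_in_SU2)
  also have "\<dots> = (\<integral>\<^sup>+k. \<Phi> (zonal (diag c ** k ** diag c)) \<partial>eK)"
    using SO2_subset_SU2 by (intro nn_integral_eK_cong \<Phi> SU2_mult diag_in_SU2) auto
  also have "\<dots> = (\<integral>\<^sup>+x. \<Phi> (zonal x) * ?f x \<partial>m_U)"
    using z by (simp add: nn_integral_extend[OF sets_m_K] nn_integral_m_K_zonal c_def)
  also have "\<dots> = (\<integral>\<^sup>+x. \<Phi> (zonal x) * ?f x \<partial>eU)"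
    by (rule nn_integral_extend[OF sets_m_U, symmetric]) measurable
  \<comment> \<open>The density is constant on double cosets, so it may enter the average over the
    double coset of x, and disintegration then removes that average.\<close>
  also have "\<dots> = (\<integral>\<^sup>+x. (\<integral>\<^sup>+y. h y * ?f y \<partial>\<mu> x) \<partial>eU)"
  proof (rule nn_integral_eU_cong)
    fix x assume x: "x \<in> SU2"
    have "(\<integral>\<^sup>+y. h y * ?f y \<partial>\<mu> x) = (\<integral>\<^sup>+k. (\<integral>\<^sup>+l. h (k ** x ** l) * ?f (k ** x ** l) \<partial>eK) \<partial>eK)"
      by (rule nn_integral_double_coset[OF _ x]) measurable
    also have "\<dots> = (\<integral>\<^sup>+k. (\<integral>\<^sup>+l. h (k ** x ** l) * ?f x \<partial>eK) \<partial>eK)"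
      by (intro nn_integral_eK_cong) (simp add: zonal_biinvariant x)
    also have "\<dots> = (\<integral>\<^sup>+y. h y \<partial>\<mu> x) * ?f x"
      by (simp add: nn_integral_multc nn_integral_double_coset x)
    finally show "\<Phi> (zonal x) * ?f x = (\<integral>\<^sup>+y. h y * ?f y \<partial>\<mu> x)"
      by (simp add: \<Phi> x)
  qed
  also have "\<dots> = (\<integral>\<^sup>+x. h x * ?f x \<partial>eU)"
    by (rule nn_integral_m_U_disintegrate[symmetric]) measurable
  also have "\<dots> = (\<integral>\<^sup>+x. h x * ?f x \<partial>m_U)"
    by (rule nn_integral_extend[OF sets_m_U]) measurable
  also have "\<dots> = (\<integral>\<^sup>+x. h x \<partial>density m_U ?f)"
    by (subst nn_integral_density)
      (auto intro!: borel_measurable_restrict_sets[OF sets_m_U] simp: mult.commute)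
  finally show "(\<integral>\<^sup>+x. h x \<partial>mconv (\<mu> a) (\<mu> a)) = (\<integral>\<^sup>+x. h x \<partial>density m_U ?f)" .
qed

section \<open>Square integrability\<close>

lemma mconv_return_one:
  assumes M: "prob_space M" "sets M = sets (restrict_space borel SU2)"
  shows "mconv M (return (restrict_space borel SU2) (mat 1)) = M"
proof (rule measure_eqI_SU2[OF sets_mconv M(2)])
  let ?\<delta> = "return (restrict_space borel SU2) (mat 1 :: complex^2^2)"
  have one: "mat 1 \<in> space (restrict_space borel SU2)"
    by (simp add: space_restrict_space mat_1_in_SU2)
  fix h :: "complex^2^2 \<Rightarrow> ennreal" assume [measurable]: "h \<in> borel_measurable borel"
  have "(\<integral>\<^sup>+y. h (x ** y) \<partial>extend ?\<delta>) = h x" for x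
  proof -
    have h: "(\<lambda>y. h (x ** y)) \<in> borel_measurable borel"
      by measurable
    then show ?thesis
      using nn_integral_return[OF one measurable_restrict_space1[OF h]]
      by (simp add: nn_integral_extend)
  qed
  then have "(\<integral>\<^sup>+x. h x \<partial>mconv M ?\<delta>) = (\<integral>\<^sup>+x. h x \<partial>extend M)"
    using M by (simp add: nn_integral_mconv prob_space_return[OF one])
  then show "(\<integral>\<^sup>+x. h x \<partial>mconv M ?\<delta>) = (\<integral>\<^sup>+x. h x \<partial>M)"
    by (simp add: nn_integral_extend[OF M(2)])
qed

text \<open>The convolution of the measure M with the function g: on SU(2), where M lives, the
  conjugate transpose is the inverse.\<close>

definition smear :: "(complex^2^2) measure \<Rightarrow> (complex^2^2 \<Rightarrow> ennreal) \<Rightarrow> complex^2^2 \<Rightarrow> ennreal" where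
  "smear M g x = (\<integral>\<^sup>+y. g (ctranspose y ** x) \<partial>extend M)"

lemma borel_measurable_smear:
  assumes M: "prob_space M" "sets M = sets (restrict_space borel SU2)"
    and [measurable]: "g \<in> borel_measurable borel"
  shows "smear M g \<in> borel_measurable borel"
proof -
  interpret eM: prob_space "extend M" by (rule prob_space_extend[OF M])
  show ?thesis unfolding smear_def by measurable
qed

text \<open>Left invariance of Haar measure moves y from the test function to the density. Absolute
  continuity thus passes from each convolution power to the next.\<close>

lemma mconv_density:
  assumes M: "prob_space M" "sets M = sets (restrict_space borel SU2)"
    and [measurable]: "g \<in> borel_measurable borel" and prob: "prob_space (density m_U g)"
  shows "mconv M (density m_U g) = density m_U (smear M g)"
proof (rule measure_eqI_SU2[OF sets_mconv])
  show "sets (density m_U (smear M g)) = sets (restrict_space borel SU2)"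
    by (simp add: sets_m_U)
  interpret eM: prob_space "extend M" by (rule prob_space_extend[OF M])
  note [measurable] = borel_measurable_smear[OF M assms(3)]
  have dens: "(\<integral>\<^sup>+x. h x \<partial>density m_U g) = (\<integral>\<^sup>+x. h x * g x \<partial>eU)"
    if [measurable]: "g \<in> borel_measurable borel" "h \<in> borel_measurable borel" for g h
    by (simp add: nn_integral_density borel_measurable_restrict_sets[OF sets_m_U]
        nn_integral_extend[OF sets_m_U] mult.commute)
  fix h :: "complex^2^2 \<Rightarrow> ennreal" assume [measurable]: "h \<in> borel_measurable borel"
  have "(\<integral>\<^sup>+x. h x \<partial>mconv M (density m_U g))
      = (\<integral>\<^sup>+y. (\<integral>\<^sup>+x. h (y ** x) \<partial>extend (density m_U g)) \<partial>extend M)"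
    by (rule nn_integral_mconv[OF M prob]) (simp_all add: sets_m_U)
  also have "\<dots> = (\<integral>\<^sup>+y. (\<integral>\<^sup>+x. h (y ** x) * g x \<partial>eU) \<partial>extend M)"
    by (simp add: nn_integral_extend[of "density m_U g" SU2] sets_m_U dens)
  also have "\<dots> = (\<integral>\<^sup>+y. (\<integral>\<^sup>+x. h x * g (ctranspose y ** x) \<partial>eU) \<partial>extend M)"
  proof (rule nn_integral_cong_AE)
    show "AE y in extend M. (\<integral>\<^sup>+x. h (y ** x) * g x \<partial>eU) = (\<integral>\<^sup>+x. h x * g (ctranspose y ** x) \<partial>eU)"
      using AE_extend[OF M(2) sets_SU2]
    proof eventually_elim
      fix y :: "complex^2^2" assume y: "y \<in> SU2"
      show "(\<integral>\<^sup>+x. h (y ** x) * g x \<partial>eU) = (\<integral>\<^sup>+x. h x * g (ctranspose y ** x) \<partial>eU)"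
        using nn_integral_eU_translate(1)[of "\<lambda>x. h (y ** x) * g x" "ctranspose y"] y
        by (simp add: matrix_mul_assoc SU2_ctranspose_mult ctranspose_in_SU2)
    qed
  qed
  also have "\<dots> = (\<integral>\<^sup>+x. (\<integral>\<^sup>+y. h x * g (ctranspose y ** x) \<partial>extend M) \<partial>eU)"
    by (rule nn_integral_swap) (auto intro: eM.prob_space_axioms eU.prob_space_axioms)
  also have "\<dots> = (\<integral>\<^sup>+x. h x * smear M g x \<partial>eU)"
    by (simp add: nn_integral_cmult smear_def)
  also have "\<dots> = (\<integral>\<^sup>+x. h x \<partial>density m_U (smear M g))"
    by (simp add: dens)
  finally show "(\<integral>\<^sup>+x. h x \<partial>mconv M (density m_U g)) = (\<integral>\<^sup>+x. h x \<partial>density m_U (smear M g))" .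
qed

text \<open>Cauchy-Schwarz against the constant 1 bounds the squared average by the average of the
  squares, and translations preserve the L^2 norm.\<close>

lemma smear_L2:
  assumes M: "prob_space M" "sets M = sets (restrict_space borel SU2)"
    and [measurable]: "g \<in> borel_measurable borel"
  shows "(\<integral>\<^sup>+x. (smear M g x)\<^sup>2 \<partial>eU) \<le> (\<integral>\<^sup>+x. (g x)\<^sup>2 \<partial>eU)"
proof -
  interpret eM: prob_space "extend M" by (rule prob_space_extend[OF M])
  have "(\<integral>\<^sup>+x. (smear M g x)\<^sup>2 \<partial>eU) \<le> (\<integral>\<^sup>+x. (\<integral>\<^sup>+y. (g (ctranspose y ** x))\<^sup>2 \<partial>extend M) \<partial>eU)"
  proof (rule nn_integral_mono)
    fix x :: "complex^2^2"
    show "(smear M g x)\<^sup>2 \<le> (\<integral>\<^sup>+y. (g (ctranspose y ** x))\<^sup>2 \<partial>extend M)"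
      using Cauchy_Schwarz_nn_integral[of "\<lambda>y. g (ctranspose y ** x)" "extend M" "\<lambda>_. 1"]
      by (simp add: smear_def eM.emeasure_space_1[simplified])
  qed
  also have "\<dots> = (\<integral>\<^sup>+y. (\<integral>\<^sup>+x. (g (ctranspose y ** x))\<^sup>2 \<partial>eU) \<partial>extend M)"
    by (rule nn_integral_swap) (auto intro: eM.prob_space_axioms eU.prob_space_axioms)
  also have "\<dots> = (\<integral>\<^sup>+y. (\<integral>\<^sup>+x. (g x)\<^sup>2 \<partial>eU) \<partial>extend M)"
  proof (rule nn_integral_cong_AE)
    show "AE y in extend M. (\<integral>\<^sup>+x. (g (ctranspose y ** x))\<^sup>2 \<partial>eU) = (\<integral>\<^sup>+x. (g x)\<^sup>2 \<partial>eU)"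
      using AE_extend[OF M(2) sets_SU2]
    proof eventually_elim
      fix y :: "complex^2^2" assume y: "y \<in> SU2"
      then show "(\<integral>\<^sup>+x. (g (ctranspose y ** x))\<^sup>2 \<partial>eU) = (\<integral>\<^sup>+x. (g x)\<^sup>2 \<partial>eU)"
        using nn_integral_eU_translate(1)[of "\<lambda>x. (g x)\<^sup>2"] by (simp add: ctranspose_in_SU2)
    qed
  qed
  also have "\<dots> = (\<integral>\<^sup>+x. (g x)\<^sup>2 \<partial>eU)"
    by (simp add: eM.emeasure_space_1[simplified])
  finally show ?thesis .
qed

text \<open>Writing the square as a double integral and translating by \<open>y\<close> leaves the law of
  \<open>y'\<^sup>-\<^sup>1 y\<close>, which is the convolution square because \<open>\<mu> a\<close> is invariant under inversion.\<close>

lemma smear_square_integral: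
  assumes a: "a \<in> SU2" and conv: "mconv (\<mu> a) (\<mu> a) = density m_U f"
    and [measurable]: "f \<in> borel_measurable borel"
  shows "(\<integral>\<^sup>+x. (smear (\<mu> a) f x)\<^sup>2 \<partial>eU) = (\<integral>\<^sup>+w. (\<integral>\<^sup>+x. f w * (f x * f (w ** x)) \<partial>eU) \<partial>eU)"
proof -
  note M = prob_space_double_coset_measure[OF a] sets_double_coset_measure[of m_K a]
  let ?M = "extend (\<mu> a)"
  interpret eM: prob_space ?M by (rule prob_space_extend[OF M])
  define G where "G = (\<lambda>w. \<integral>\<^sup>+x. f x * f (w ** x) \<partial>eU)"
  have [measurable]: "G \<in> borel_measurable borel"
    unfolding G_def by measurable
  have "(\<integral>\<^sup>+x. (smear (\<mu> a) f x)\<^sup>2 \<partial>eU)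
      = (\<integral>\<^sup>+x. (\<integral>\<^sup>+y. (\<integral>\<^sup>+y'. f (ctranspose y ** x) * f (ctranspose y' ** x) \<partial>?M) \<partial>?M) \<partial>eU)"
    by (simp add: smear_def power2_eq_square nn_integral_cmult nn_integral_multc)
  also have "\<dots> = (\<integral>\<^sup>+y. (\<integral>\<^sup>+x. (\<integral>\<^sup>+y'. f (ctranspose y ** x) * f (ctranspose y' ** x) \<partial>?M) \<partial>eU) \<partial>?M)"
    by (rule nn_integral_swap) (auto intro: eM.prob_space_axioms eU.prob_space_axioms)
  also have "\<dots> = (\<integral>\<^sup>+y. (\<integral>\<^sup>+y'. (\<integral>\<^sup>+x. f (ctranspose y ** x) * f (ctranspose y' ** x) \<partial>eU) \<partial>?M) \<partial>?M)"
    by (intro nn_integral_cong nn_integral_swap) (auto intro: eM.prob_space_axioms eU.prob_space_axioms)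
  also have "\<dots> = (\<integral>\<^sup>+y. (\<integral>\<^sup>+y'. G (ctranspose y' ** y) \<partial>?M) \<partial>?M)"
  proof (rule nn_integral_cong_AE)
    show "AE y in ?M. (\<integral>\<^sup>+y'. (\<integral>\<^sup>+x. f (ctranspose y ** x) * f (ctranspose y' ** x) \<partial>eU) \<partial>?M)
        = (\<integral>\<^sup>+y'. G (ctranspose y' ** y) \<partial>?M)"
      using AE_extend[OF M(2) sets_SU2]
    proof eventually_elim
      fix y :: "complex^2^2" assume y: "y \<in> SU2"
      have "(\<integral>\<^sup>+x. f (ctranspose y ** x) * f (ctranspose y' ** x) \<partial>eU) = G (ctranspose y' ** y)" for y'
        using nn_integral_eU_translate(1)[of "\<lambda>x. f (ctranspose y ** x) * f (ctranspose y' ** x)" y] y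
        by (simp add: matrix_mul_assoc SU2_ctranspose_mult G_def)
      then show "(\<integral>\<^sup>+y'. (\<integral>\<^sup>+x. f (ctranspose y ** x) * f (ctranspose y' ** x) \<partial>eU) \<partial>?M)
        = (\<integral>\<^sup>+y'. G (ctranspose y' ** y) \<partial>?M)" by simp
    qed
  qed
  also have "\<dots> = (\<integral>\<^sup>+y. (\<integral>\<^sup>+y'. G (y' ** y) \<partial>?M) \<partial>?M)"
  proof (rule nn_integral_cong)
    fix y
    show "(\<integral>\<^sup>+y'. G (ctranspose y' ** y) \<partial>?M) = (\<integral>\<^sup>+y'. G (y' ** y) \<partial>?M)"
      using nn_integral_double_coset_inverse[of "\<lambda>y'. G (y' ** y)", OF _ a]
      by (simp add: nn_integral_extend[OF M(2)])
  qed
  also have "\<dots> = (\<integral>\<^sup>+y'. (\<integral>\<^sup>+y. G (y' ** y) \<partial>?M) \<partial>?M)"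
    by (rule nn_integral_swap) (auto intro: eM.prob_space_axioms)
  also have "\<dots> = (\<integral>\<^sup>+w. G w \<partial>mconv (\<mu> a) (\<mu> a))"
    by (rule nn_integral_mconv[OF M M, symmetric]) measurable
  also have "\<dots> = (\<integral>\<^sup>+w. f w * G w \<partial>eU)"
    unfolding conv
    by (simp add: nn_integral_density borel_measurable_restrict_sets[OF sets_m_U] nn_integral_extend[OF sets_m_U])
  also have "\<dots> = (\<integral>\<^sup>+w. (\<integral>\<^sup>+x. f w * (f x * f (w ** x)) \<partial>eU) \<partial>eU)"
    by (simp add: G_def nn_integral_cmult)
  finally show ?thesis .
qed

text \<open>The largest of \<open>ab\<close>, \<open>bc\<close>, \<open>ca\<close>, raised to the power \<open>3/2\<close>, bounds
  \<open>abc = (ab \<cdot> bc \<cdot> ca)\<^sup>1\<^sup>/\<^sup>2\<close>.\<close>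

lemma triple_product_le:
  fixes a b c :: real
  assumes "0 \<le> a" "0 \<le> b" "0 \<le> c"
  shows "a * b * c \<le> (a * b) powr (3/2) + (b * c) powr (3/2) + (a * c) powr (3/2)"
proof -
  define m where "m = max (a * b) (max (b * c) (a * c))"
  have m: "0 \<le> m" "a * b \<le> m" "b * c \<le> m" "a * c \<le> m"
    using assms by (auto simp: m_def le_max_iff_disj)
  have "(a * b * c)\<^sup>2 = (a * b) * (b * c) * (a * c)"
    by (simp add: power2_eq_square)
  also have "\<dots> \<le> m * m * m"
    using m assms by (intro mult_mono) auto
  also have "\<dots> = (m powr (3/2))\<^sup>2"
    using m by (cases "m = 0") (simp_all add: power2_eq_square power3_eq_cube flip: powr_add)
  finally have "a * b * c \<le> m powr (3/2)"
    by (rule power2_le_imp_le) simp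
  also have "\<dots> \<le> (a * b) powr (3/2) + (b * c) powr (3/2) + (a * c) powr (3/2)"
    by (auto simp: m_def max_def)
  finally show ?thesis .
qed

text \<open>A qualitative form of Young's inequality. For independent Haar variables w and x, any
  two of w, x and w ** x are again independent and Haar distributed, so each of the three terms of
  the pointwise bound integrates to the product of two finite integrals.\<close>

lemma trilinear_finite:
  fixes \<phi> :: "complex^2^2 \<Rightarrow> real"
  assumes [measurable]: "\<phi> \<in> borel_measurable borel" and nonneg: "\<And>x. 0 \<le> \<phi> x"
    and fin: "(\<integral>\<^sup>+x. ennreal (\<phi> x powr (3/2)) \<partial>eU) < \<infinity>"
  shows "(\<integral>\<^sup>+w. (\<integral>\<^sup>+x. ennreal (\<phi> w) * (ennreal (\<phi> x) * ennreal (\<phi> (w ** x))) \<partial>eU) \<partial>eU) < \<infinity>"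
proof -
  define v where "v = (\<lambda>x. ennreal (\<phi> x powr (3/2)))"
  define I where "I = (\<integral>\<^sup>+x. v x \<partial>eU)"
  have [measurable]: "v \<in> borel_measurable borel"
    unfolding v_def by measurable
  have "ennreal (\<phi> w) * (ennreal (\<phi> x) * ennreal (\<phi> (w ** x)))
      \<le> v w * v x + v x * v (w ** x) + v w * v (w ** x)" for w x
    using triple_product_le[OF nonneg nonneg nonneg, of w x "w ** x"] nonneg
    by (simp add: v_def powr_mult mult.assoc flip: ennreal_mult ennreal_plus)
  then have "(\<integral>\<^sup>+w. (\<integral>\<^sup>+x. ennreal (\<phi> w) * (ennreal (\<phi> x) * ennreal (\<phi> (w ** x))) \<partial>eU) \<partial>eU)
      \<le> (\<integral>\<^sup>+w. (\<integral>\<^sup>+x. v w * v x + v x * v (w ** x) + v w * v (w ** x) \<partial>eU) \<partial>eU)"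
    by (intro nn_integral_mono)
  also have "\<dots> = (\<integral>\<^sup>+w. (\<integral>\<^sup>+x. v w * v x \<partial>eU) \<partial>eU) + (\<integral>\<^sup>+w. (\<integral>\<^sup>+x. v x * v (w ** x) \<partial>eU) \<partial>eU)
      + (\<integral>\<^sup>+w. (\<integral>\<^sup>+x. v w * v (w ** x) \<partial>eU) \<partial>eU)"
    by (simp add: nn_integral_add)
  also have "(\<integral>\<^sup>+w. (\<integral>\<^sup>+x. v w * v x \<partial>eU) \<partial>eU) = I * I"
    by (simp add: nn_integral_cmult nn_integral_multc I_def)
  \<comment> \<open>Here w must be integrated first: for fixed x, the map from w to w ** x is a
    right translation. The remaining term needs left translation by w.\<close>
  also have "(\<integral>\<^sup>+w. (\<integral>\<^sup>+x. v x * v (w ** x) \<partial>eU) \<partial>eU) = (\<integral>\<^sup>+x. (\<integral>\<^sup>+w. v x * v (w ** x) \<partial>eU) \<partial>eU)"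
    by (rule nn_integral_swap) (auto intro: eU.prob_space_axioms)
  also have "\<dots> = (\<integral>\<^sup>+x. v x * I \<partial>eU)"
    by (rule nn_integral_eU_cong) (simp add: nn_integral_cmult I_def nn_integral_eU_translate(2))
  also have "\<dots> = I * I"
    by (simp add: nn_integral_multc I_def)
  also have "(\<integral>\<^sup>+w. (\<integral>\<^sup>+x. v w * v (w ** x) \<partial>eU) \<partial>eU) = (\<integral>\<^sup>+w. v w * I \<partial>eU)"
    by (rule nn_integral_eU_cong) (simp add: nn_integral_cmult I_def nn_integral_eU_translate(1))
  also have "\<dots> = I * I"
    by (simp add: nn_integral_multc I_def)
  also have "I * I + I * I + I * I < \<infinity>"
    using fin by (simp add: I_def v_def ennreal_mult_less_top)
  finally show ?thesis .
qed

section \<open>Integrability of powers of the arcsine density\<close>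

lemma nn_integral_powr_interval:
  fixes e :: real
  assumes "-1 < e" "0 \<le> d"
  shows "(\<integral>\<^sup>+x. ennreal (x powr e) * indicator {0..d} x \<partial>lborel) < \<infinity>"
proof -
  have "(\<integral>\<^sup>+x. ennreal (indicator {0..d} x * x powr e) \<partial>lborel) = ennreal (d powr (e + 1) / (e + 1))"
    using assms by (intro nn_integral_has_integral_lebesgue has_integral_powr_from_0) auto
  then show ?thesis
    by (simp add: ennreal_mult'' ennreal_indicator mult.commute)
qed

lemma convolution_density_nonneg: "0 \<le> convolution_density c z"
  by (simp add: convolution_density_def)

text \<open>On each half of the interval one of the two factors under the root is bounded below.\<close>

lemma convolution_density_powr_finite:
  assumes c: "\<bar>c\<bar> < 1"
  shows "(\<integral>\<^sup>+z. ennreal (convolution_density c z powr (3/2)) * indicator {-1..1} z \<partial>lborel) < \<infinity>"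
proof -
  define l where "l = 2 * c\<^sup>2 - 1"
  define d where "d = 1 - l"
  have "c\<^sup>2 < 1" using c by (simp add: abs_square_less_1)
  then have d: "0 < d" by (simp add: d_def l_def)
  \<comment> \<open>The first factor is the prefactor of the density raised to 3/2. The second
    bounds whichever of 1 - z and z - l is at least d / 2, and -3/4 is the exponent -1/2 of the root
    times 3/2.\<close>
  define C where "C = (2 / pi) powr (3/2) * (d / 2) powr (-3/4)"
  have C: "0 \<le> C" by (simp add: C_def)
  let ?P = "\<lambda>x. ennreal (x powr (-3/4)) * indicator {0..d} x"
  have bound: "convolution_density c z powr (3/2) \<le> C * ((1 - z) powr (-3/4) + (z - l) powr (-3/4))"
    if z: "l < z" "z < 1" for z
  proof -
    have "0 < (1 - z) * (z - l)"
      using z by simp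
    then have "sqrt ((1 - z) * (z - l)) = ((1 - z) * (z - l)) powr (1/2)"
      by (simp only: powr_half_sqrt)
    then have "convolution_density c z = 2 / (pi * ((1 - z) * (z - l)) powr (1/2))"
      using z by (simp only: convolution_density_def l_def) simp
    then have "convolution_density c z = (2 / pi) * ((1 - z) * (z - l)) powr (-1/2)"
      by (simp only: powr_minus_divide minus_divide_left[symmetric]) simp
    then have "convolution_density c z powr (3/2) = (2 / pi) powr (3/2) * ((1 - z) powr (-3/4) * (z - l) powr (-3/4))"
      using z by (simp add: powr_mult powr_powr powr_divide)
    also have "(1 - z) powr (-3/4) * (z - l) powr (-3/4)
        \<le> (d / 2) powr (-3/4) * ((1 - z) powr (-3/4) + (z - l) powr (-3/4))"
    proof (cases "1 - z \<le> d / 2")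
      case True
      then have "(z - l) powr (-3/4) \<le> (d / 2) powr (-3/4)"
        using d by (intro powr_mono2') (auto simp: d_def)
      then have "(1 - z) powr (-3/4) * (z - l) powr (-3/4) \<le> (1 - z) powr (-3/4) * (d / 2) powr (-3/4)"
        by (intro mult_left_mono) auto
      also have "\<dots> \<le> (d / 2) powr (-3/4) * ((1 - z) powr (-3/4) + (z - l) powr (-3/4))"
        by (simp add: algebra_simps)
      finally show ?thesis .
    next
      case False
      then have "(1 - z) powr (-3/4) \<le> (d / 2) powr (-3/4)"
        using d by (intro powr_mono2') auto
      then have "(1 - z) powr (-3/4) * (z - l) powr (-3/4) \<le> (d / 2) powr (-3/4) * (z - l) powr (-3/4)"
        by (intro mult_right_mono) auto
      also have "\<dots> \<le> (d / 2) powr (-3/4) * ((1 - z) powr (-3/4) + (z - l) powr (-3/4))"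
        by (simp add: algebra_simps)
      finally show ?thesis .
    qed
    finally show ?thesis
      by (simp add: C_def mult.assoc mult_left_mono)
  qed
  have "(\<integral>\<^sup>+z. ennreal (convolution_density c z powr (3/2)) * indicator {-1..1} z \<partial>lborel)
      \<le> (\<integral>\<^sup>+z. ennreal C * (?P (1 - z) + ?P (- l + z)) \<partial>lborel)"
  proof (rule nn_integral_mono)
    fix z :: real
    show "ennreal (convolution_density c z powr (3/2)) * indicator {-1..1} z
        \<le> ennreal C * (?P (1 - z) + ?P (- l + z))"
    proof (cases "l < z \<and> z < 1")
      case True
      then have "ennreal (convolution_density c z powr (3/2)) * indicator {-1..1} z
         \<le> ennreal (C * ((1 - z) powr (-3/4) + (z - l) powr (-3/4)))"
        using bound[of z] by (auto simp: indicator_def intro!: ennreal_leI)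
      also have "\<dots> = ennreal C * (?P (1 - z) + ?P (- l + z))"
        using True C by (simp add: d_def ennreal_mult ennreal_plus)
      finally show ?thesis .
    next
      case False
      then show ?thesis by (auto simp: convolution_density_def l_def)
    qed
  qed
  also have "\<dots> = ennreal C * ((\<integral>\<^sup>+z. ?P (1 - z) \<partial>lborel) + (\<integral>\<^sup>+z. ?P (- l + z) \<partial>lborel))"
    by (simp add: nn_integral_cmult nn_integral_add)
  also have "(\<integral>\<^sup>+z. ?P (- l + z) \<partial>lborel) = (\<integral>\<^sup>+z. ?P z \<partial>lborel)"
    by (rule nn_integral_lborel_translate) measurable
  also have "(\<integral>\<^sup>+z. ?P (1 - z) \<partial>lborel) = (\<integral>\<^sup>+z. ?P z \<partial>lborel)"
    using nn_integral_real_affine[of ?P "-1" 1] by simp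
  also have "ennreal C * ((\<integral>\<^sup>+z. ?P z \<partial>lborel) + (\<integral>\<^sup>+z. ?P z \<partial>lborel)) < \<infinity>"
    using nn_integral_powr_interval[of "-3/4" d] d by (simp add: ennreal_mult_less_top)
  finally show ?thesis .
qed

text \<open>For c = 0 the squared density is 4 / (pi^2 (1 - z^2)). On [0, 1) it is at least 2 /
  (pi^2 (1 - z)), because 1 + z is at most 2, and integrating this up to 1 - 1 / B gives (2 / pi^2)
  ln B, which is unbounded in B.\<close>

lemma convolution_density_square_infinite:
  "(\<integral>\<^sup>+z. (ennreal (convolution_density 0 z))\<^sup>2 * indicator {-1..1} z \<partial>lborel) = \<infinity>"
    (is "?I = _")
proof (rule ccontr)
  assume "?I \<noteq> \<infinity>"
  then obtain r where r: "0 \<le> r" "?I = ennreal r"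
    by (cases ?I) auto
  have le: "ln B * (2 / pi\<^sup>2) \<le> r" if B: "1 < B" for B :: real
  proof -
    have "(\<integral>\<^sup>+z. ennreal (2 / pi\<^sup>2 * (1 / (1 - z))) * indicator {0..1 - 1 / B} z \<partial>lborel)
        = ennreal (- (2 / pi\<^sup>2) * ln (1 - (1 - 1 / B)) - - (2 / pi\<^sup>2) * ln (1 - 0))"
    proof (rule nn_integral_FTC_Icc)
      fix z :: real assume z: "z \<in> {0..1 - 1 / B}"
      then have "z < 1" using B by (simp add: le_diff_eq) (smt (verit) divide_pos_pos)
      then show "((\<lambda>z. - (2 / pi\<^sup>2) * ln (1 - z)) has_real_derivative 2 / pi\<^sup>2 * (1 / (1 - z))) (at z)"
        by (auto intro!: derivative_eq_intros simp: field_simps power2_eq_square)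
      show "0 \<le> 2 / pi\<^sup>2 * (1 / (1 - z))"
        using \<open>z < 1\<close> by simp
    qed (use B in auto)
    also have "\<dots> = ennreal (ln B * (2 / pi\<^sup>2))"
      using B by (simp add: ln_div)
    finally have "ennreal (ln B * (2 / pi\<^sup>2)) = (\<integral>\<^sup>+z. ennreal (2 / pi\<^sup>2 * (1 / (1 - z))) * indicator {0..1 - 1 / B} z \<partial>lborel)" ..
    also have "\<dots> \<le> ?I"
    proof (rule nn_integral_mono)
      fix z :: real
      show "ennreal (2 / pi\<^sup>2 * (1 / (1 - z))) * indicator {0..1 - 1 / B} z
          \<le> (ennreal (convolution_density 0 z))\<^sup>2 * indicator {-1..1} z"
      proof (cases "z \<in> {0..1 - 1 / B}")
        case True
        then have z: "0 \<le> z" "z < 1" using B by (auto simp: le_diff_eq) (smt (verit) divide_pos_pos)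
        then have p: "0 < (1 - z) * (z + 1)" by simp
        have "(convolution_density 0 z)\<^sup>2 = 4 / (pi\<^sup>2 * ((1 - z) * (z + 1)))"
          using z p by (simp add: convolution_density_def power_divide power_mult_distrib)
        moreover have "2 / pi\<^sup>2 * (1 / (1 - z)) \<le> 4 / (pi\<^sup>2 * ((1 - z) * (z + 1)))"
          using z p by (simp add: divide_simps)
        ultimately show ?thesis
          using True z convolution_density_nonneg[of 0 z]
          by (simp add: ennreal_power ennreal_leI)
      qed simp
    qed
    finally show ?thesis
      using r by simp
  qed
  \<comment> \<open>Chosen so that the logarithmic lower bound equals r + 1.\<close>
  define B where "B = exp ((r + 1) * pi\<^sup>2 / 2)"
  have "1 < B" using r by (simp add: B_def)
  then have "ln B * (2 / pi\<^sup>2) \<le> r" by (rule le)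
  moreover have "ln B * (2 / pi\<^sup>2) = r + 1"
    by (simp add: B_def)
  ultimately show False
    by simp
qed

text \<open>At height 1 or -1 the first column is purely real or purely imaginary. In the first case
  \<open>a\<close> commutes with all rotations, in the second it inverts them, and either way it
  normalizes SO(2).\<close>

lemma zonal_less_1:
  assumes a: "a \<in> SU2 - normalizer_in SU2 SO2"
  shows "\<bar>zonal a\<bar> < 1"
proof (rule ccontr)
  assume "\<not> \<bar>zonal a\<bar> < 1"
  with a zonal_bounds[of a] have z: "zonal a = 1 \<or> zonal a = -1" by auto
  obtain p q where x: "a = su2 p q" and pq: "(norm p)\<^sup>2 + (norm q)\<^sup>2 = 1"
    using a by (auto elim: SU2_cases)
  have "(Re p)\<^sup>2 + (Re q)\<^sup>2 + ((Im p)\<^sup>2 + (Im q)\<^sup>2) = 1"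
    using pq by (simp add: cmod_power2)
  with z have "(Im p)\<^sup>2 + (Im q)\<^sup>2 = 0 \<or> (Re p)\<^sup>2 + (Re q)\<^sup>2 = 0"
    unfolding x zonal_su2 by linarith
  then obtain s :: real where s: "s * s = 1" and comm: "a ** rot t = rot (s * t) ** a" for t
  proof
    assume "(Im p)\<^sup>2 + (Im q)\<^sup>2 = 0"
    then have "a ** rot t = rot (1 * t) ** a" for t
      by (simp add: x rot_def su2_mult su2_eq_iff complex_eq_iff sum_power2_eq_zero_iff)
    then show thesis using that[of 1] by simp
  next
    assume "(Re p)\<^sup>2 + (Re q)\<^sup>2 = 0"
    then have "a ** rot t = rot (-1 * t) ** a" for t
      by (simp add: x rot_def su2_mult su2_eq_iff complex_eq_iff sum_power2_eq_zero_iff)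
    then show thesis using that[of "-1"] by simp
  qed
  have "a ** rot t ** matrix_inv a = rot (s * t)" for t
    using a by (simp add: comm matrix_inv_SU2 SU2_ctranspose_mult flip: matrix_mul_assoc)
  then have "(\<lambda>h. a ** h ** matrix_inv a) ` SO2 = range (\<lambda>t. rot (s * t))"
    by (simp add: SO2_eq_range_rot image_image)
  also have "\<dots> = rot ` range ((*) s)"
    by (rule image_image[symmetric])
  \<comment> \<open>Since s * s = 1, multiplication by s is its own inverse.\<close>
  also have "range ((*) s) = UNIV"
    by (rule surjI[of _ "(*) s"]) (simp add: s flip: mult.assoc)
  finally show False
    using a by (simp add: normalizer_in_def SO2_eq_range_rot)
qed

text \<open>The quarter turn is the witness: as e^2 = \<i>, conjugating it by \<open>diag 0\<close>
  produces the entry -\<i>, which is not real.\<close>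

lemma diag_0_not_in_normalizer: "diag 0 \<notin> normalizer_in SU2 SO2"
proof
  assume "diag 0 \<in> normalizer_in SU2 SO2"
  then have "diag 0 ** rot (pi / 2) ** matrix_inv (diag 0) \<in> SO2"
    unfolding normalizer_in_def using rot_in_SO2 by blast
  moreover define e where "e = Complex (sqrt (1 / 2)) (sqrt (1 / 2))"
  have "diag 0 = su2 e 0"
    by (simp add: diag_def e_def)
  moreover have "su2 e 0 ** rot (pi / 2) ** su2 (cnj e) 0 = su2 0 (- \<i>)"
    by (simp add: rot_def su2_mult su2_eq_iff complex_eq_iff e_def)
  ultimately have "su2 0 (- \<i>) \<in> SO2"
    using matrix_inv_SU2[OF diag_in_SU2[of 0]] by (simp add: ctranspose_su2)
  then have "su2 0 (- \<i>) $ 2 $ 1 \<in> \<real>"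
    unfolding SO2_def by blast
  then show False
    by (simp add: complex_is_Real_iff)
qed

section \<open>Densities of the convolution powers\<close>

lemma mconv_power_double_coset:
  assumes "a \<in> SU2"
  shows "prob_space (mconv_power (\<mu> a) p)"
    and "sets (mconv_power (\<mu> a) p) = sets (restrict_space borel SU2)"
proof (induction p)
  case 0
  show "prob_space (mconv_power (\<mu> a) 0)"
    by (simp add: prob_space_return space_restrict_space mat_1_in_SU2)
next
  case (Suc p)
  then show "prob_space (mconv_power (\<mu> a) (Suc p))"
    by (simp add: prob_space_mconv prob_space_double_coset_measure assms sets_double_coset_measure)
qed (simp_all add: sets_mconv)

lemma mconv_power_2_density:
  assumes a: "a \<in> SU2" "\<bar>zonal a\<bar> < 1"
  shows "mconv_power (\<mu> a) 2 = density m_U (\<lambda>x. ennreal (convolution_density (zonal a) (zonal x)))"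
  using assms
  by (simp add: numeral_2_eq_2 mconv_return_one prob_space_double_coset_measure sets_double_coset_measure
      mconv_double_coset_density)

text \<open>The induction starts at the cube, where the trilinear bound gives the first square
  integrable density. From there on each further factor is an L^2 contraction of an explicit
  density.\<close>

lemma mconv_power_density_L2:
  assumes a: "a \<in> SU2" "\<bar>zonal a\<bar> < 1" and "3 \<le> p"
  obtains g where "g \<in> borel_measurable borel" "mconv_power (\<mu> a) p = density m_U g"
    "(\<integral>\<^sup>+x. (g x)\<^sup>2 \<partial>eU) < \<infinity>"
proof -
  note M = prob_space_double_coset_measure[OF a(1)] sets_double_coset_measure[of m_K a]
  have Suc_density: "mconv_power (\<mu> a) (Suc p) = density m_U (smear (\<mu> a) g)"
    if "g \<in> borel_measurable borel" "mconv_power (\<mu> a) p = density m_U g" for p g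
    using mconv_density[OF M that(1)] mconv_power_double_coset(1)[OF a(1), of p] that(2) by simp
  have "\<exists>g\<in>borel_measurable borel. mconv_power (\<mu> a) p = density m_U g \<and> (\<integral>\<^sup>+x. (g x)\<^sup>2 \<partial>eU) < \<infinity>"
    using \<open>3 \<le> p\<close>
  proof (induction p rule: dec_induct)
    case base
    define \<phi> where "\<phi> = (\<lambda>x. convolution_density (zonal a) (zonal x))"
    have [measurable]: "\<phi> \<in> borel_measurable borel"
      unfolding \<phi>_def by measurable
    let ?f = "\<lambda>x. ennreal (\<phi> x)"
    have conv: "mconv_power (\<mu> a) 2 = density m_U ?f"
      using mconv_power_2_density[OF a] by (simp add: \<phi>_def)
    have "(\<integral>\<^sup>+x. ennreal (\<phi> x powr (3/2)) \<partial>eU)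
        = (\<integral>\<^sup>+z. ennreal (convolution_density (zonal a) z powr (3/2)) * indicator {-1..1} z \<partial>lborel) / 2"
      unfolding \<phi>_def
      using nn_integral_m_U_zonal[of "\<lambda>z. ennreal (convolution_density (zonal a) z powr (3/2))"]
      by (simp add: nn_integral_extend[OF sets_m_U])
    also have "\<dots> < \<infinity>"
      using convolution_density_powr_finite[OF a(2)] by (simp add: less_top[symmetric] ennreal_divide_eq_top_iff)
    finally have "(\<integral>\<^sup>+x. (smear (\<mu> a) ?f x)\<^sup>2 \<partial>eU) < \<infinity>"
      using smear_square_integral[OF a(1) mconv_double_coset_density[OF a, folded \<phi>_def]]
        trilinear_finite[of \<phi>] by (simp add: \<phi>_def convolution_density_nonneg)
    then show ?case
      using Suc_density[OF _ conv] borel_measurable_smear[OF M, of ?f]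
      by (intro bexI[of _ "smear (\<mu> a) ?f"]) (simp_all add: eval_nat_numeral)
  next
    case (step p)
    then obtain g where g: "g \<in> borel_measurable borel" "mconv_power (\<mu> a) p = density m_U g"
      "(\<integral>\<^sup>+x. (g x)\<^sup>2 \<partial>eU) < \<infinity>" by blast
    have "(\<integral>\<^sup>+x. (smear (\<mu> a) g x)\<^sup>2 \<partial>eU) < \<infinity>"
      using smear_L2[OF M g(1)] g(3) by (rule order.strict_trans1)
    then show ?case
      using Suc_density[OF g(1,2)] borel_measurable_smear[OF M g(1)]
      by blast
  qed
  then show thesis using that by blast
qed

text \<open>\<open>RN_deriv\<close> is determined almost everywhere, so square integrability can be
  tested on any explicit density.\<close>

lemma in_L2_RN_deriv_density:
  assumes [measurable]: "g \<in> borel_measurable borel" and N: "N = density m_U g"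
  shows "absolutely_continuous m_U N"
    and "in_L2 m_U (RN_deriv m_U N) \<longleftrightarrow> (\<integral>\<^sup>+x. (g x)\<^sup>2 \<partial>eU) < \<infinity>"
proof -
  interpret U: prob_space m_U by (rule prob_space_m_U)
  have g: "g \<in> borel_measurable m_U"
    by (rule borel_measurable_restrict_sets[OF sets_m_U]) fact
  show "absolutely_continuous m_U N"
    unfolding N by (rule absolutely_continuousI_density[OF g])
  have "AE x in m_U. g x = RN_deriv m_U N x"
    by (rule U.RN_deriv_unique[OF g N[symmetric]])
  then have "(\<integral>\<^sup>+x. (RN_deriv m_U N x)\<^sup>2 \<partial>m_U) = (\<integral>\<^sup>+x. (g x)\<^sup>2 \<partial>m_U)"
    by (intro nn_integral_cong_AE) (auto elim: eventually_mono)
  then show "in_L2 m_U (RN_deriv m_U N) \<longleftrightarrow> (\<integral>\<^sup>+x. (g x)\<^sup>2 \<partial>eU) < \<infinity>"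
    by (simp add: in_L2_def nn_integral_extend[OF sets_m_U])
qed

theorem theorem1:
  shows "(\<forall>a \<in> SU2 - normalizer_in SU2 SO2. \<forall>p::nat. p \<ge> 3 \<longrightarrow>
            absolutely_continuous m_U (mconv_power (double_coset_measure m_K a) p) \<and>
            in_L2 m_U (RN_deriv m_U (mconv_power (double_coset_measure m_K a) p)))
       \<and> (\<exists>a \<in> SU2 - normalizer_in SU2 SO2.
            absolutely_continuous m_U (mconv_power (double_coset_measure m_K a) 2) \<and>
            \<not> in_L2 m_U (RN_deriv m_U (mconv_power (double_coset_measure m_K a) 2)))"
proof (intro conjI ballI allI impI)
  fix a p assume a: "a \<in> SU2 - normalizer_in SU2 SO2" and p: "(p::nat) \<ge> 3"
  obtain g where g: "g \<in> borel_measurable borel" "mconv_power (\<mu> a) p = density m_U g"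
    "(\<integral>\<^sup>+x. (g x)\<^sup>2 \<partial>eU) < \<infinity>"
    using mconv_power_density_L2[of a p] zonal_less_1[OF a] a p by blast
  show "absolutely_continuous m_U (mconv_power (\<mu> a) p)"
    "in_L2 m_U (RN_deriv m_U (mconv_power (\<mu> a) p))"
    using in_L2_RN_deriv_density[OF g(1,2)] g(3) by simp_all
next
  \<comment> \<open>The equator, c = 0, makes the support of the density the whole of [-1, 1] and
    gives it the simple form 2 / (pi * sqrt (1 - z^2)).\<close>
  let ?a = "diag 0"
  have zonal: "zonal ?a = 0"
    by (simp add: zonal_diag)
  define g where "g = (\<lambda>x. ennreal (convolution_density 0 (zonal x)))"
  have g: "g \<in> borel_measurable borel"
    unfolding g_def by measurable
  have conv: "mconv_power (\<mu> ?a) 2 = density m_U g"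
    using mconv_power_2_density[OF diag_in_SU2, of 0] by (simp add: zonal g_def)
  have "(\<integral>\<^sup>+x. (g x)\<^sup>2 \<partial>eU) = \<infinity>"
    using nn_integral_m_U_zonal[of "\<lambda>z. (ennreal (convolution_density 0 z))\<^sup>2"]
    by (simp add: g_def nn_integral_extend[OF sets_m_U] convolution_density_square_infinite[simplified]
        ennreal_top_divide)
  then show "\<exists>a \<in> SU2 - normalizer_in SU2 SO2.
            absolutely_continuous m_U (mconv_power (\<mu> a) 2) \<and>
            \<not> in_L2 m_U (RN_deriv m_U (mconv_power (\<mu> a) 2))"
    using in_L2_RN_deriv_density[OF g conv] diag_in_SU2[of 0] diag_0_not_in_normalizer
    by (intro bexI[of _ ?a]) auto
qed

end
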